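(* Let $\omega$ be a structured weight and let $\mathcal{B}=(e_n)_{n=1}^\infty$ be a basis of a Banach space $\mathbb{X}$. Then $\mathcal{B}$ is $\omega$-semi-greedy if and only if it is $\omega$-almost greedy.
   Context: $\mathbb{X}$ is a Banach space over $\mathbb{K}=\mathbb{R}$ or $\mathbb{C}$. A basis of $\mathbb{X}$ means a semi-normalized Schauder basis $(e_n)_{n=1}^\infty$, i.e. $0<\inf_n\|e_n\|\le\sup_n\|e_n\|<\infty$, with biorthogonal functionals $(e_n^* )_{n=1}^\infty\subset\mathbb{X}^*$. $\mathbb{N}^{<\infty}$ is the set of finite subsets of $\mathbb{N}$. $P_A(x)=\sum_{n\in A}e_n^*(x)e_n$. A structured weight is a function $\omega:\mathcal{P}(\mathbb{N})\to[0,\infty]$, with value at $A$ written $w(A)$ and $w_n:=w(\{n\})$, such that: (a) $w(\emptyset)=0$; (b) $w(A)<\infty$ if $|A|<\infty$; (c) $w(A)\in(0,\infty]$ for each nonempty $A\subset\mathbb{N}$; (d) $w(A)\to0$ as $\sum_{n\in A}w_n\to0$ (for every $\eta>0$ there is $\theta>0$ such that $\sum_{n\in A}w_n<\theta$ implies $w(A)<\eta$); (e) $w(A)\to\infty$ as $\sum_{n\in A}w_n\to\infty$ (for every $M$ there is $K$ such that $\sum_{n\in A}w_n>K$ implies $w(A)>M$); (f) there are arbitrarily large $N\in\mathbb{N}$ for each of which there exists $\varepsilon>0$ with $w(\{N,n\})-w_n>\varepsilon$ for all $n\in\mathbb{N}$, $n\ne N$. Greedy sets: for $x\in\mathbb{X}$,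 $m\in\mathbb{N}$, a greedy set of order $m$ of $x$ is a set $\Lambda_m(x)\subset\mathbb{N}$ with $|\Lambda_m(x)|=m$ and $\min_{n\in\Lambda_m(x)}|e_n^*(x)|\ge\max_{n\notin\Lambda_m(x)}|e_n^*(x)|$; the corresponding greedy sum is $G_m(x)=\sum_{n\in\Lambda_m(x)}e_n^*(x)e_n$. A Chebyshev greedy sum $CG_m(x)$ associated with $\Lambda_m(x)$ is a vector with $\operatorname{supp}(CG_m(x))\subset\Lambda_m(x)$ and $\|x-CG_m(x)\|=\min\{\|x-\sum_{n\in\Lambda_m(x)}a_ne_n\|:(a_n)\subset\mathbb{K}\}$, where $\operatorname{supp}(y)=\{n:e_n^*(y)\neq0\}$. For $B\subset\mathbb{N}$ let $$\sigma^\omega_B(x)=\inf\Big\{\Big\|x-\sum_{n\in A}a_ne_n\Big\|: A\in\mathbb{N}^{<\infty},\ w(A\setminus B)\le w(B\setminus A),\ a_n\in\mathbb{K}\Big\},$$ $$\widetilde\sigma^\omega_B(x)=\inf\{\|x-P_A(x)\|: A\in\mathbb{N}^{<\infty},\ w(A\setminus B)\le w(B\setminus A)\}.$$ $\mathcal{B}$ is $\omega$-semi-greedy if there is $C\ge1$ such that $\|x-CG_m(x)\|\le C\sigma^\omega_{\Lambda_m(x)}(x)$ for all $x\in\mathbb{X}$, $m\in\mathbb{N}$ and all greedy sets $\Lambda_m(x)$. $\mathcal{B}$ is $\omega$-almost greedy if there is $C\ge1$ such that $\|x-G_m(x)\|\le C\widetilde\sigma^\omega_{\Lambda_m(x)}(x)$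 for all $x\in\mathbb{X}$, $m\in\mathbb{N}$ and all greedy sets $\Lambda_m(x)$. *)

theory Defs
  imports "HOL-Analysis.Analysis"
begin

text \<open>
  The positive integers indexing a basis are encoded as the type \<open>nat\<close>, so bases start at
  index \<open>0\<close>. Definitions depending on the scalar field take the scalar multiplication as a
  parameter \<open>smul\<close>: it is \<open>scaleR\<close> for real spaces, and a multiplication satisfying the
  following locale for complex ones.
\<close>

locale complex_banach = vector_space smul
  for smul :: "complex \<Rightarrow> 'a::banach \<Rightarrow> 'a" +
  assumes scale_of_real: "smul (complex_of_real r) x = r *\<^sub>R x"
    and norm_scale: "norm (smul c x) = cmod c * norm x"


section \<open>Structured weights\<close>

text \<open>
  The infinite sums are taken in \<open>ennreal\<close>, where every family is summable. The difference in the
  last clause involves only finite values, and \<open>\<epsilon> > 0\<close> makes truncation of \<open>-\<close> harmless.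
\<close>

definition structured_weight :: "(nat set \<Rightarrow> ennreal) \<Rightarrow> bool" where
  "structured_weight w \<longleftrightarrow>
     w {} = 0 \<and>
     (\<forall>A. finite A \<longrightarrow> w A < \<infinity>) \<and>
     (\<forall>A. A \<noteq> {} \<longrightarrow> 0 < w A) \<and>
     (\<forall>\<eta>>0. \<exists>\<theta>>0. \<forall>A. (\<Sum>\<^sub>\<infinity>n\<in>A. w {n}) < \<theta> \<longrightarrow> w A < \<eta>) \<and>
     (\<forall>M<\<infinity>. \<exists>K<\<infinity>. \<forall>A. K < (\<Sum>\<^sub>\<infinity>n\<in>A. w {n}) \<longrightarrow> M < w A) \<and>
     (\<forall>k. \<exists>N\<ge>k. \<exists>\<epsilon>>0. \<forall>n. n \<noteq> N \<longrightarrow> \<epsilon> < w {N, n} - w {n})"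


section \<open>Bases\<close>

definition schauder_basis :: "('k::real_normed_field \<Rightarrow> 'a::banach \<Rightarrow> 'a) \<Rightarrow> (nat \<Rightarrow> 'a) \<Rightarrow> bool" where
  "schauder_basis smul e \<longleftrightarrow> (\<forall>x. \<exists>!a. (\<lambda>n. smul (a n) (e n)) sums x)"

definition seminormalized :: "(nat \<Rightarrow> 'a::real_normed_vector) \<Rightarrow> bool" where
  "seminormalized e \<longleftrightarrow> 0 < (INF n. norm (e n)) \<and> bdd_above (range (\<lambda>n. norm (e n)))"

definition dual_elem :: "('k::real_normed_field \<Rightarrow> 'a::banach \<Rightarrow> 'a) \<Rightarrow> ('a \<Rightarrow> 'k) \<Rightarrow> bool" where
  "dual_elem smul f \<longleftrightarrow>
     Vector_Spaces.linear smul (*) f \<and> (\<exists>K. \<forall>x. norm (f x) \<le> K * norm x)"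

text \<open>
  \<open>basis smul e es\<close>: the sequence \<open>e\<close> is a basis and \<open>es\<close> is its sequence of biorthogonal
  functionals. For a Schauder basis \<open>e\<close> there is exactly one such \<open>es\<close>.
\<close>

definition basis ::
  "('k::real_normed_field \<Rightarrow> 'a::banach \<Rightarrow> 'a) \<Rightarrow> (nat \<Rightarrow> 'a) \<Rightarrow> (nat \<Rightarrow> 'a \<Rightarrow> 'k) \<Rightarrow> bool" where
  "basis smul e es \<longleftrightarrow>
     schauder_basis smul e \<and> seminormalized e \<and>
     (\<forall>n. dual_elem smul (es n)) \<and>
     (\<forall>n k. es n (e k) = (if n = k then 1 else 0))"


section \<open>Greedy and Chebyshev greedy sums\<close>

definition proj ::
  "('k::real_normed_field \<Rightarrow> 'a::banach \<Rightarrow> 'a) \<Rightarrow> (nat \<Rightarrow> 'a) \<Rightarrow> (nat \<Rightarrow> 'a \<Rightarrow> 'k) \<Rightarrow>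
    nat set \<Rightarrow> 'a \<Rightarrow> 'a" where
  "proj smul e es A x = (\<Sum>n\<in>A. smul (es n x) (e n))"

definition supp :: "(nat \<Rightarrow> 'a \<Rightarrow> 'k::zero) \<Rightarrow> 'a \<Rightarrow> nat set" where
  "supp es y = {n. es n y \<noteq> 0}"

definition greedy_set ::
  "(nat \<Rightarrow> 'a \<Rightarrow> 'k::real_normed_field) \<Rightarrow> 'a \<Rightarrow> nat \<Rightarrow> nat set \<Rightarrow> bool" where
  "greedy_set es x m \<Lambda> \<longleftrightarrow>
     finite \<Lambda> \<and> card \<Lambda> = m \<and>
     (\<forall>n\<in>\<Lambda>. \<forall>k. k \<notin> \<Lambda> \<longrightarrow> norm (es n x) \<ge> norm (es k x))"

definition chebyshev_greedy_sum ::
  "('k::real_normed_field \<Rightarrow> 'a::banach \<Rightarrow> 'a) \<Rightarrow> (nat \<Rightarrow> 'a) \<Rightarrow> (nat \<Rightarrow> 'a \<Rightarrow> 'k) \<Rightarrow>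
    'a \<Rightarrow> nat set \<Rightarrow> 'a \<Rightarrow> bool" where
  "chebyshev_greedy_sum smul e es x \<Lambda> y \<longleftrightarrow>
     supp es y \<subseteq> \<Lambda> \<and>
     (\<exists>a. norm (x - y) = norm (x - (\<Sum>n\<in>\<Lambda>. smul (a n) (e n)))) \<and>
     (\<forall>a. norm (x - y) \<le> norm (x - (\<Sum>n\<in>\<Lambda>. smul (a n) (e n))))"


section \<open>Weighted approximation errors and greedy-type properties\<close>

definition sigma_w ::
  "('k::real_normed_field \<Rightarrow> 'a::banach \<Rightarrow> 'a) \<Rightarrow> (nat \<Rightarrow> 'a) \<Rightarrow> (nat set \<Rightarrow> ennreal) \<Rightarrow>
    nat set \<Rightarrow> 'a \<Rightarrow> real" where
  "sigma_w smul e w B x =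
     Inf {norm (x - (\<Sum>n\<in>A. smul (a n) (e n))) | A a. finite A \<and> w (A - B) \<le> w (B - A)}"

definition sigma_tilde_w ::
  "('k::real_normed_field \<Rightarrow> 'a::banach \<Rightarrow> 'a) \<Rightarrow> (nat \<Rightarrow> 'a) \<Rightarrow> (nat \<Rightarrow> 'a \<Rightarrow> 'k) \<Rightarrow>
    (nat set \<Rightarrow> ennreal) \<Rightarrow> nat set \<Rightarrow> 'a \<Rightarrow> real" where
  "sigma_tilde_w smul e es w B x =
     Inf {norm (x - proj smul e es A x) | A. finite A \<and> w (A - B) \<le> w (B - A)}"

text \<open>
  A Chebyshev greedy sum of \<open>x\<close> associated with \<open>\<Lambda>\<close> need not be unique, but all of them have
  the same distance to \<open>x\<close>, so the quantification over \<open>y\<close> below is immaterial.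
\<close>

definition semi_greedy ::
  "('k::real_normed_field \<Rightarrow> 'a::banach \<Rightarrow> 'a) \<Rightarrow> (nat set \<Rightarrow> ennreal) \<Rightarrow>
    (nat \<Rightarrow> 'a) \<Rightarrow> (nat \<Rightarrow> 'a \<Rightarrow> 'k) \<Rightarrow> bool" where
  "semi_greedy smul w e es \<longleftrightarrow>
     (\<exists>C\<ge>1. \<forall>x. \<forall>m\<ge>1. \<forall>\<Lambda> y.
        greedy_set es x m \<Lambda> \<longrightarrow> chebyshev_greedy_sum smul e es x \<Lambda> y \<longrightarrow>
        norm (x - y) \<le> C * sigma_w smul e w \<Lambda> x)"

definition almost_greedy ::
  "('k::real_normed_field \<Rightarrow> 'a::banach \<Rightarrow> 'a) \<Rightarrow> (nat set \<Rightarrow> ennreal) \<Rightarrow>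
    (nat \<Rightarrow> 'a) \<Rightarrow> (nat \<Rightarrow> 'a \<Rightarrow> 'k) \<Rightarrow> bool" where
  "almost_greedy smul w e es \<longleftrightarrow>
     (\<exists>C\<ge>1. \<forall>x. \<forall>m\<ge>1. \<forall>\<Lambda>.
        greedy_set es x m \<Lambda> \<longrightarrow>
        norm (x - proj smul e es \<Lambda> x) \<le> C * sigma_tilde_w smul e es w \<Lambda> x)"

end

(*
  Both properties are equivalent to the conjunction of quasi-greediness and a weighted form of
  democracy for disjoint sets.  The substantial implication is that a semi-greedy basis is
  quasi-greedy.  If the sum of the weights w_n is finite, all finite sets far out are lighter than
  {0}, and the basis is equivalent to the unit vector basis of c_0.  Otherwise a greedy set can be
  exchanged against an interval beyond the support of x whose weight just exceeds that of the
  greedy set, and the basis constant separates the interval from x.  Once the basis is quasi-greedy,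
  democracy follows because the coefficients on a set D cannot be cancelled by a Chebyshev
  correction outside D.
*)

theory Submission
  imports Defs
begin

section \<open>Coefficients and partial sums\<close>

text \<open>Semi-greediness gives no control over the coefficients that a Chebyshev sum puts on the
  greedy set, so an estimate can be read off only where that set does not interfere. Before
  quasi-greediness is known, the projections available with a uniform bound are the initial partial
  sums. This is why the auxiliary vectors lie beyond the support of the vector under study: one cut
  at an index then discards the unknown correction. Once quasi-greediness is known, coefficients of
  modulus at least \<open>\<alpha>\<close> can be read off on any set, at the price of a factor
  \<open>2 * C\<^sup>2\<close>. The reverse implications rest on one consequence of
  quasi-greediness: the sign sum over a level set of the coefficients is a combination of greedy
  projections, so truncating large coefficients to modulus \<open>\<alpha>\<close> is a bounded
  operation. Structured weights are not assumed monotone. Sets are therefore compared only through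
  the sums of their singleton weights or through the minimality of an interval. The scalar field is
  kept abstract, normed and with compact closed balls, so that the real and complex cases share one
  argument.\<close>

locale seminormalized_basis = vector_space smul
  for smul :: "'k::{real_normed_field,heine_borel} \<Rightarrow> 'a::banach \<Rightarrow> 'a" +
  fixes e :: "nat \<Rightarrow> 'a" and es :: "nat \<Rightarrow> 'a \<Rightarrow> 'k"
  assumes smul_of_real: "smul (of_real r) x = r *\<^sub>R x"
    and norm_smul: "norm (smul c x) = norm c * norm x"
    and basis: "basis smul e es"
begin

definition lincomb :: "nat set \<Rightarrow> (nat \<Rightarrow> 'k) \<Rightarrow> 'a" where
  "lincomb A a = (\<Sum>n\<in>A. smul (a n) (e n))"

abbreviation P :: "nat set \<Rightarrow> 'a \<Rightarrow> 'a" where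
  "P \<equiv> proj smul e es"

lemma P_eq_lincomb: "P A x = lincomb A (\<lambda>n. es n x)"
  by (simp add: proj_def lincomb_def)

lemma lincomb_cong: "(\<And>n. n \<in> A \<Longrightarrow> a n = b n) \<Longrightarrow> lincomb A a = lincomb A b"
  by (simp add: lincomb_def)

lemma lincomb_add: "lincomb A (\<lambda>n. a n + b n) = lincomb A a + lincomb A b"
  by (simp add: lincomb_def scale_left_distrib sum.distrib)

lemma lincomb_diff: "lincomb A (\<lambda>n. a n - b n) = lincomb A a - lincomb A b"
  by (simp add: lincomb_def scale_left_diff_distrib sum_subtractf)

lemma lincomb_scale: "lincomb A (\<lambda>n. c * a n) = smul c (lincomb A a)"
  by (simp add: lincomb_def scale_sum_right)

lemma lincomb_scaleR: "lincomb A (\<lambda>n. of_real r * a n) = r *\<^sub>R lincomb A a"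
  by (simp add: lincomb_scale smul_of_real)

lemma lincomb_empty [simp]: "lincomb {} a = 0"
  by (simp add: lincomb_def)

lemma lincomb_Un:
  "finite A \<Longrightarrow> finite B \<Longrightarrow> A \<inter> B = {} \<Longrightarrow> lincomb (A \<union> B) a = lincomb A a + lincomb B a"
  by (simp add: lincomb_def sum.union_disjoint)

lemma lincomb_mono_neutral:
  "finite B \<Longrightarrow> A \<subseteq> B \<Longrightarrow> (\<And>n. n \<in> B - A \<Longrightarrow> a n = 0) \<Longrightarrow> lincomb B a = lincomb A a"
  unfolding lincomb_def by (rule sum.mono_neutral_right) auto

lemma
  shows es_add: "es n (x + y) = es n x + es n y"
    and es_smul: "es n (smul c x) = c * es n x"
  using basis by (auto simp: basis_def dual_elem_def Vector_Spaces.linear_iff)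

lemma es_0 [simp]: "es n 0 = 0"
  using es_smul[of n 0 0] by simp

lemma es_diff: "es n (x - y) = es n x - es n y"
  using es_add[of n "x - y" y] by simp

lemma es_scaleR: "es n (r *\<^sub>R x) = of_real r * es n x"
  using es_smul[of n "of_real r" x] by (simp add: smul_of_real)

lemma es_sum: "es n (\<Sum>i\<in>A. f i) = (\<Sum>i\<in>A. es n (f i))"
  by (induction A rule: infinite_finite_induct) (auto simp: es_add)

lemma es_e: "es n (e k) = (if n = k then 1 else 0)"
  using basis by (simp add: basis_def)

lemma es_lincomb: "finite A \<Longrightarrow> es n (lincomb A a) = (if n \<in> A then a n else 0)"
  by (simp add: lincomb_def es_sum es_smul es_e if_distrib cong: if_cong)

lemma es_P: "finite A \<Longrightarrow> es n (P A x) = (if n \<in> A then es n x else 0)"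
  by (simp add: P_eq_lincomb es_lincomb)

lemma P_add: "P A (x + y) = P A x + P A y"
  by (simp add: P_eq_lincomb es_add lincomb_add)

lemma P_diff: "P A (x - y) = P A x - P A y"
  by (simp add: P_eq_lincomb es_diff lincomb_diff)

lemma P_0 [simp]: "P A 0 = 0"
  using P_diff[of A 0 0] by simp

lemma P_scaleR: "P A (r *\<^sub>R x) = r *\<^sub>R P A x"
  by (simp add: P_eq_lincomb es_scaleR lincomb_scaleR)

lemma P_lincomb:
  assumes "finite A" "finite B"
  shows "P A (lincomb B a) = lincomb (A \<inter> B) a"
proof -
  have "P A (lincomb B a) = lincomb A (\<lambda>n. if n \<in> B then a n else 0)"
    by (simp add: P_eq_lincomb es_lincomb assms)
  also have "\<dots> = lincomb (A \<inter> B) (\<lambda>n. if n \<in> B then a n else 0)"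
    by (rule lincomb_mono_neutral) (use assms in auto)
  also have "\<dots> = lincomb (A \<inter> B) a"
    by (rule lincomb_cong) auto
  finally show ?thesis .
qed

lemma P_P: "finite A \<Longrightarrow> finite B \<Longrightarrow> P A (P B x) = P (A \<inter> B) x"
  by (simp add: P_eq_lincomb[of B] P_lincomb P_eq_lincomb[of "A \<inter> B"])

lemma norm_lincomb_le: "norm (lincomb A a) \<le> (\<Sum>n\<in>A. norm (a n) * norm (e n))"
  unfolding lincomb_def by (rule sum_norm_le) (simp add: norm_smul)

section \<open>Continuity, the basis expansion and the uniform bounds that follow from it\<close>

lemma es_bounded_linear: "bounded_linear (es n)"
proof -
  obtain K where "\<And>x. norm (es n x) \<le> K * norm x"
    using basis unfolding basis_def dual_elem_def by meson
  then show ?thesis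
    by (intro bounded_linear_intro[of _ K])
       (auto simp: es_add es_scaleR scaleR_conv_of_real mult.commute)
qed

lemma bounded_linear_smul_left: "bounded_linear (\<lambda>c. smul c v)"
proof (intro bounded_linear_intro[of _ "norm v"])
  show "smul (r *\<^sub>R c) v = r *\<^sub>R smul c v" for r c
    by (simp add: scaleR_conv_of_real smul_of_real flip: scale_scale)
qed (auto simp: scale_left_distrib norm_smul)

lemma bounded_linear_P: "bounded_linear (P A)"
  unfolding proj_def
  by (intro bounded_linear_sum
        bounded_linear_compose[OF bounded_linear_smul_left es_bounded_linear])

text \<open>The continuous functional \<open>es k\<close> may be applied termwise to the expansion
  given by the Schauder property; biorthogonality then identifies its coefficients.\<close>

lemma sums_coeffs: "(\<lambda>n. smul (es n x) (e n)) sums x"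
proof -
  obtain a where a: "(\<lambda>n. smul (a n) (e n)) sums x"
    using basis unfolding basis_def schauder_basis_def by meson
  have "es k x = a k" for k
  proof -
    have "(\<lambda>n. es k (smul (a n) (e n))) sums es k x"
      by (rule bounded_linear.sums[OF es_bounded_linear a])
    moreover have "(\<lambda>n. es k (smul (a n) (e n))) = (\<lambda>n. if n = k then a n else 0)"
      by (auto simp: es_smul es_e)
    ultimately show ?thesis
      using sums_single[of k a] sums_unique2 by metis
  qed
  with a show ?thesis by simp
qed

lemma P_lessThan_tendsto: "(\<lambda>k. P {..<k} x) \<longlonglongrightarrow> x"
  using sums_coeffs[of x] by (simp add: sums_def proj_def)

lemma P_eq_self:
  assumes "finite A" "\<And>n. n \<notin> A \<Longrightarrow> es n x = 0"
  shows "P A x = x"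
proof -
  have "(\<lambda>n. smul (es n x) (e n)) sums (\<Sum>n\<in>A. smul (es n x) (e n))"
    by (rule sums_finite) (use assms in auto)
  then show ?thesis
    using sums_coeffs sums_unique2 unfolding proj_def by metis
qed

lemma e_bounded: "\<exists>c>0. \<exists>M. \<forall>n. c \<le> norm (e n) \<and> norm (e n) \<le> M"
proof -
  have "0 < (INF n. norm (e n))" "bdd_above (range (\<lambda>n. norm (e n)))"
    using basis by (auto simp: basis_def seminormalized_def)
  moreover have "(INF n. norm (e n)) \<le> norm (e n)" for n
    by (rule cINF_lower) (auto intro: bdd_belowI[of _ 0])
  ultimately show ?thesis
    unfolding bdd_above_def by auto
qed

text \<open>The uniform boundedness principle, applied to the partial sum projections.\<close>

lemma basis_constant: "\<exists>K\<ge>1. \<forall>k x. norm (P {..<k} x) \<le> K * norm x"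
proof -
  \<comment> \<open>Convergent partial sums are bounded for each \<open>x\<close>, so these closed
    sets cover the space, and by Baire one of them contains a ball.\<close>
  define F where "F M = {x. \<forall>k. norm (P {..<k} x) \<le> real M}" for M :: nat
  have closed: "closed (F M)" for M
  proof -
    have "F M = (\<Inter>k. {x. norm (P {..<k} x) \<le> real M})"
      by (auto simp: F_def)
    moreover have "closed {x. norm (P {..<k} x) \<le> real M}" for k
      by (intro closed_Collect_le continuous_intros
            bounded_linear.continuous_on[OF bounded_linear_P])
    ultimately show ?thesis by auto
  qed
  have "x \<in> (\<Union>M. F M)" for x
  proof -
    have "Bseq (\<lambda>k. P {..<k} x)"
      using P_lessThan_tendsto by (intro convergent_imp_Bseq) (auto simp: convergent_def)
    then obtain B where "\<And>k. norm (P {..<k} x) \<le> B"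
      unfolding Bseq_def by auto
    moreover obtain M where "B \<le> real M"
      using real_arch_simple by blast
    ultimately show ?thesis
      unfolding F_def using order_trans by blast
  qed
  then have "(\<Union>M. F M) = UNIV" by blast
  moreover have "interior (\<Union> (range F)) = {}" if "\<And>M. interior (F M) = {}"
    using Baire_category_alt[of "euclidean :: 'a topology" "range F"] that closed
    by (auto simp: completely_metrizable_space_euclidean)
  ultimately obtain M where "interior (F M) \<noteq> {}"
    by fastforce
  then obtain x0 r where r: "r > 0" "cball x0 r \<subseteq> F M"
    by (meson mem_interior_cball ex_in_conv)
  have bound: "norm (P {..<k} x) \<le> (2 * real M / r) * norm x" for k x
  proof (cases "x = 0")
    case True
    then show ?thesis by simp
  next
    case False
    \<comment> \<open>\<open>y\<close> stays in the ball around \<open>x0\<close>; subtracting the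
      centre isolates the direction of \<open>x\<close> and costs the factor 2.\<close>
    define y where "y = x0 + (r / norm x) *\<^sub>R x"
    have "norm (P {..<k} y) \<le> M" "norm (P {..<k} x0) \<le> M"
      using r False by (auto simp: F_def y_def dist_norm subset_iff)
    then have "norm (P {..<k} y - P {..<k} x0) \<le> 2 * M"
      using norm_triangle_ineq4[of "P {..<k} y" "P {..<k} x0"] by linarith
    also have "P {..<k} y - P {..<k} x0 = (r / norm x) *\<^sub>R P {..<k} x"
      by (simp add: y_def P_add P_scaleR)
    finally show ?thesis
      using r False by (simp add: field_simps)
  qed
  show ?thesis
  proof (intro exI conjI allI)
    fix k and x :: 'a
    have "(2 * real M / r) * norm x \<le> max 1 (2 * real M / r) * norm x"
      by (intro mult_right_mono) auto
    then show "norm (P {..<k} x) \<le> max 1 (2 * real M / r) * norm x"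
      using bound[of k x] by linarith
  qed auto
qed

text \<open>A term of the expansion is the difference of two consecutive partial sums, and the norms
  of the \<open>e n\<close> stay away from 0.\<close>

lemma coeff_bound: "\<exists>H\<ge>1. \<forall>n x. norm (es n x) \<le> H * norm x"
proof -
  obtain K where K: "K \<ge> 1" "\<And>k x. norm (P {..<k} x) \<le> K * norm x"
    using basis_constant by auto
  obtain c where c: "c > 0" "\<And>n. c \<le> norm (e n)"
    using e_bounded by blast
  have "norm (es n x) \<le> (2 * K / c) * norm x" for n x
  proof -
    have "P {..<Suc n} x - P {..<n} x = smul (es n x) (e n)"
      by (simp add: proj_def)
    then have "norm (es n x) * norm (e n) \<le> 2 * K * norm x"
      using norm_triangle_ineq4[of "P {..<Suc n} x" "P {..<n} x"] K(2)[of "Suc n" x] K(2)[of n x]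
      by (simp add: norm_smul)
    moreover have "norm (es n x) * c \<le> norm (es n x) * norm (e n)"
      by (intro mult_left_mono c) auto
    ultimately show ?thesis
      using c(1) by (simp add: field_simps)
  qed
  moreover have "(2 * K / c) * norm x \<le> max 1 (2 * K / c) * norm x" for x :: 'a
    by (intro mult_right_mono) auto
  ultimately show ?thesis
    by (intro exI[of _ "max 1 (2 * K / c)"] conjI allI) (rule max.cobounded1, rule order_trans)
qed

text \<open>The terms of the expansion tend to 0 while the \<open>e n\<close> do not. This makes
  level sets of coefficients usable as index sets even when \<open>x\<close> has infinite
  support.\<close>

lemma finite_large_coeffs:
  assumes "\<alpha> > 0"
  shows "finite {n. \<alpha> \<le> norm (es n x)}"
proof -
  obtain c where c: "c > 0" "\<And>n. c \<le> norm (e n)"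
    using e_bounded by blast
  have "(\<lambda>n. smul (es n x) (e n)) \<longlonglongrightarrow> 0"
    using sums_coeffs sums_summable summable_LIMSEQ_zero by blast
  then obtain N where N: "\<And>n. n \<ge> N \<Longrightarrow> norm (smul (es n x) (e n)) < \<alpha> * c"
    using LIMSEQ_D[of "\<lambda>n. smul (es n x) (e n)" 0 "\<alpha> * c"] assms c by auto
  have "n < N" if "\<alpha> \<le> norm (es n x)" for n
  proof (rule ccontr)
    assume "\<not> n < N"
    then have "norm (es n x) * norm (e n) < \<alpha> * c"
      using N[of n] by (simp add: norm_smul)
    moreover have "\<alpha> * c \<le> norm (es n x) * norm (e n)"
      using that c assms by (intro mult_mono) auto
    ultimately show False by simp
  qed
  then have "{n. \<alpha> \<le> norm (es n x)} \<subseteq> {..<N}"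
    by auto
  then show ?thesis
    by (rule finite_subset) simp
qed

text \<open>Cutting at \<open>p\<close> recovers the head \<open>u\<close> from
  \<open>u + v\<close>. In the applications one of the two contains an uncontrolled Chebyshev
  correction and the other is the part to be estimated.\<close>

lemma tail_bound:
  assumes K: "\<And>k x. norm (P {..<k} x) \<le> K * norm x"
    and "P {..<p} u = u" "P {..<p} v = 0"
  shows "norm u \<le> K * norm (u + v)" and "norm v \<le> (1 + K) * norm (u + v)"
proof -
  have "P {..<p} (u + v) = u"
    using assms by (simp add: P_add)
  then show u: "norm u \<le> K * norm (u + v)"
    by (metis K)
  have "norm v \<le> norm (u + v) + norm u"
    using norm_triangle_ineq4[of "u + v" u] by simp
  with u show "norm v \<le> (1 + K) * norm (u + v)"
    by (simp add: algebra_simps)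
qed


section \<open>Chebyshev greedy sums\<close>

text \<open>Each induction step takes the continuous image of a closed ball of scalars times a
  compact set; the ball is compact because the scalar field has the Heine-Borel property.\<close>

lemma compact_lincombs: "finite A \<Longrightarrow> compact {lincomb A a | a. \<forall>n\<in>A. norm (a n) \<le> R}"
proof (induction A rule: finite_induct)
  case empty
  then show ?case by simp
next
  case (insert k A)
  let ?S = "{lincomb A a | a. \<forall>n\<in>A. norm (a n) \<le> R}"
  have "{lincomb (insert k A) a | a. \<forall>n\<in>insert k A. norm (a n) \<le> R}
      = (\<lambda>(c, v). smul c (e k) + v) ` (cball 0 R \<times> ?S)" (is "?L = ?R")
  proof (intro equalityI subsetI)
    fix z assume "z \<in> ?L"
    then obtain a where a: "z = lincomb (insert k A) a" "\<forall>n\<in>insert k A. norm (a n) \<le> R"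
      by auto
    then show "z \<in> ?R"
      using insert by (intro image_eqI[of _ _ "(a k, lincomb A a)"]) (auto simp: lincomb_def)
  next
    fix z assume "z \<in> ?R"
    then obtain c a where "norm c \<le> R" "\<forall>n\<in>A. norm (a n) \<le> R" "z = smul c (e k) + lincomb A a"
      by auto
    moreover have "lincomb A (a(k := c)) = lincomb A a"
      using insert by (intro lincomb_cong) auto
    ultimately show "z \<in> ?L"
      using insert by (intro CollectI exI[of _ "a(k := c)"]) (auto simp: lincomb_def)
  qed
  moreover have "continuous_on UNIV (\<lambda>(c, v). smul c (e k) + v)"
    unfolding case_prod_unfold
    by (intro continuous_intros bounded_linear.continuous_on[OF bounded_linear_smul_left])
  ultimately show ?case
    using insert by (auto intro!: compact_continuous_image compact_Times
        intro: continuous_on_subset)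
qed

text \<open>A vector supported in a finite set equals its projection onto that set, and its own
  coefficients then witness that the minimum is attained.\<close>

lemma chebyshev_greedy_sum_iff:
  assumes "finite \<Lambda>"
  shows "chebyshev_greedy_sum smul e es x \<Lambda> y \<longleftrightarrow>
    (\<exists>c. y = lincomb \<Lambda> c) \<and> (\<forall>a. norm (x - y) \<le> norm (x - lincomb \<Lambda> a))"
proof
  assume *: "chebyshev_greedy_sum smul e es x \<Lambda> y"
  then have "y = lincomb \<Lambda> (\<lambda>n. es n y)"
    using P_eq_self[of \<Lambda> y] assms
    unfolding chebyshev_greedy_sum_def supp_def P_eq_lincomb by fastforce
  with * show "(\<exists>c. y = lincomb \<Lambda> c) \<and> (\<forall>a. norm (x - y) \<le> norm (x - lincomb \<Lambda> a))"
    by (auto simp: chebyshev_greedy_sum_def lincomb_def)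
next
  assume "(\<exists>c. y = lincomb \<Lambda> c) \<and> (\<forall>a. norm (x - y) \<le> norm (x - lincomb \<Lambda> a))"
  then show "chebyshev_greedy_sum smul e es x \<Lambda> y"
    using assms
    by (auto simp: chebyshev_greedy_sum_def supp_def es_lincomb simp flip: lincomb_def split: if_splits)
qed

text \<open>\<open>semi_greedy\<close> quantifies over Chebyshev sums; existence is what lets it
  yield an estimate for every greedy set.\<close>

lemma chebyshev_greedy_sum_exists:
  assumes "finite \<Lambda>"
  shows "\<exists>y. chebyshev_greedy_sum smul e es x \<Lambda> y"
proof -
  obtain H where H: "H \<ge> 1" "\<And>n x. norm (es n x) \<le> H * norm x"
    using coeff_bound by auto
  \<comment> \<open>A combination with a coefficient above \<open>R\<close> has norm above
    \<open>2 * norm x\<close>, hence is no closer to \<open>x\<close> than 0 is. Minimising over the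
    compact set \<open>?S\<close> is therefore enough.\<close>
  define R where "R = H * (2 * norm x)"
  let ?S = "{lincomb \<Lambda> a | a. \<forall>n\<in>\<Lambda>. norm (a n) \<le> R}"
  have R: "R \<ge> 0"
    using H by (simp add: R_def)
  have "lincomb \<Lambda> (\<lambda>_. 0) \<in> ?S"
    using R by auto
  then have zero: "0 \<in> ?S"
    by (simp add: lincomb_def)
  have "\<exists>y\<in>?S. \<forall>z\<in>?S. norm (x - y) \<le> norm (x - z)"
  proof (rule continuous_attains_inf)
    show "compact ?S"
      by (rule compact_lincombs[OF assms])
    show "continuous_on ?S (\<lambda>z. norm (x - z))"
      by (intro continuous_intros)
  qed (use zero in blast)
  then obtain y where y: "y \<in> ?S" "\<And>z. z \<in> ?S \<Longrightarrow> norm (x - y) \<le> norm (x - z)"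
    by blast
  have "norm (x - y) \<le> norm (x - lincomb \<Lambda> a)" for a
  proof (cases "lincomb \<Lambda> a \<in> ?S")
    case False
    then obtain n where n: "n \<in> \<Lambda>" "R < norm (a n)"
      by force
    then have "H * (2 * norm x) < H * norm (lincomb \<Lambda> a)"
      using H(2)[of n "lincomb \<Lambda> a"] assms by (simp add: es_lincomb R_def)
    then have "norm x \<le> norm (x - lincomb \<Lambda> a)"
      using H(1) norm_triangle_ineq3[of x "lincomb \<Lambda> a"] by simp
    then show ?thesis
      using y(2)[OF zero] by simp
  qed (use y in auto)
  then show ?thesis
    using y(1) assms by (auto simp: chebyshev_greedy_sum_iff)
qed

lemma sigma_w_le:
  assumes "finite A" "w (A - B) \<le> w (B - A)"
  shows "sigma_w smul e w B x \<le> norm (x - lincomb A a)"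
  unfolding sigma_w_def lincomb_def
  by (rule cInf_lower) (use assms in \<open>auto intro!: bdd_belowI[of _ 0]\<close>)

text \<open>The form in which semi-greediness is applied: the competitor on \<open>A\<close> is
  chosen freely, while the coefficients \<open>c\<close> remain unknown.\<close>

lemma semi_greedyE:
  assumes "semi_greedy smul w e es"
  obtains C where "C \<ge> 1" "\<And>x \<Lambda> A a. greedy_set es x (card \<Lambda>) \<Lambda> \<Longrightarrow> \<Lambda> \<noteq> {} \<Longrightarrow> finite A \<Longrightarrow>
    w (A - \<Lambda>) \<le> w (\<Lambda> - A) \<Longrightarrow> \<exists>c. norm (x - lincomb \<Lambda> c) \<le> C * norm (x - lincomb A a)"
proof -
  obtain C where C: "C \<ge> 1" "\<And>x m \<Lambda> y. m \<ge> 1 \<Longrightarrow> greedy_set es x m \<Lambda> \<Longrightarrow>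
      chebyshev_greedy_sum smul e es x \<Lambda> y \<Longrightarrow> norm (x - y) \<le> C * sigma_w smul e w \<Lambda> x"
    using assms unfolding semi_greedy_def by blast
  have "\<exists>c. norm (x - lincomb \<Lambda> c) \<le> C * norm (x - lincomb A a)"
    if "greedy_set es x (card \<Lambda>) \<Lambda>" "\<Lambda> \<noteq> {}" "finite A" "w (A - \<Lambda>) \<le> w (\<Lambda> - A)" for x \<Lambda> A a
  proof -
    have fin: "finite \<Lambda>"
      using that by (simp add: greedy_set_def)
    then obtain y where y: "chebyshev_greedy_sum smul e es x \<Lambda> y"
      using chebyshev_greedy_sum_exists by blast
    have "norm (x - y) \<le> C * sigma_w smul e w \<Lambda> x"
      using that fin y by (intro C(2)[of "card \<Lambda>"]) (auto simp: Suc_le_eq card_gt_0_iff)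
    also have "\<dots> \<le> C * norm (x - lincomb A a)"
      using C(1) that by (intro mult_left_mono sigma_w_le) auto
    finally show ?thesis
      using y fin by (auto simp: chebyshev_greedy_sum_iff)
  qed
  with C(1) show thesis by (rule that)
qed

end


section \<open>Quasi-greedy and democratic bases\<close>

text \<open>Layer cake: the weighted sum is an average of sums over superlevel sets of the weight.\<close>

lemma norm_weighted_sum_le:
  fixes f :: "'i \<Rightarrow> 'v::real_normed_vector" and g :: "'i \<Rightarrow> real"
  assumes "finite A" "0 \<le> r" "\<And>n. n \<in> A \<Longrightarrow> 0 \<le> g n \<and> g n \<le> r"
    and "\<And>H. H \<subseteq> A \<Longrightarrow> (\<And>h k. h \<in> H \<Longrightarrow> k \<in> A - H \<Longrightarrow> g k \<le> g h) \<Longrightarrow> norm (sum f H) \<le> M"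
  shows "norm (\<Sum>n\<in>A. g n *\<^sub>R f n) \<le> r * M"
  using assms
proof (induction "card A" arbitrary: A g r)
  case 0
  then show ?case
    using "0.prems"(4)[of "{}"] by simp
next
  case (Suc m)
  then have "A \<noteq> {}" by auto
  obtain n0 where n0: "n0 \<in> A" "\<And>k. k \<in> A \<Longrightarrow> g n0 \<le> g k"
    using ex_is_arg_min_if_finite[OF Suc.prems(1) \<open>A \<noteq> {}\<close>, of g]
    by (auto simp: is_arg_min_linorder)
  \<comment> \<open>The smallest weight is split off as a constant over all of \<open>A\<close>. The
    remaining weights lie between 0 and \<open>r - g n0\<close>, and their superlevel sets are still
    superlevel sets of \<open>g\<close> in \<open>A\<close>.\<close>
  have "norm (\<Sum>n\<in>A - {n0}. (g n - g n0) *\<^sub>R f n) \<le> (r - g n0) * M"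
  proof (rule Suc.hyps(1))
    show "norm (sum f H) \<le> M"
      if "H \<subseteq> A - {n0}"
        and H: "\<And>h k. h \<in> H \<Longrightarrow> k \<in> A - {n0} - H \<Longrightarrow> g k - g n0 \<le> g h - g n0" for H
    proof (rule Suc.prems(4))
      show "g k \<le> g h" if "h \<in> H" "k \<in> A - H" for h k
        using H[of h k] n0 that \<open>H \<subseteq> A - {n0}\<close> by (cases "k = n0") auto
    qed (use that in auto)
  qed (use Suc.hyps(2) Suc.prems n0 in auto)
  moreover have "norm (sum f A) \<le> M"
    by (rule Suc.prems(4)) auto
  then have "norm (g n0 *\<^sub>R sum f A) \<le> g n0 * M"
    using Suc.prems(3)[OF n0(1)] by (simp add: mult_left_mono)
  moreover have "(\<Sum>n\<in>A. g n *\<^sub>R f n) = g n0 *\<^sub>R sum f A + (\<Sum>n\<in>A - {n0}. (g n - g n0) *\<^sub>R f n)"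
  proof -
    have "(\<Sum>n\<in>A - {n0}. (g n - g n0) *\<^sub>R f n) = (\<Sum>n\<in>A. (g n - g n0) *\<^sub>R f n)"
      using Suc.prems(1) n0 by (simp add: sum.remove[of A n0])
    then show ?thesis
      by (simp add: scaleR_left_diff_distrib sum_subtractf scaleR_sum_right)
  qed
  ultimately show ?case
    using norm_triangle_ineq[of "g n0 *\<^sub>R sum f A" "\<Sum>n\<in>A - {n0}. (g n - g n0) *\<^sub>R f n"]
    by (simp add: algebra_simps)
qed

context seminormalized_basis
begin

definition quasi_greedy :: "real \<Rightarrow> bool" where
  "quasi_greedy C \<longleftrightarrow> C \<ge> 1 \<and>
     (\<forall>x \<Lambda>. greedy_set es x (card \<Lambda>) \<Lambda> \<longrightarrow> norm (P \<Lambda> x) \<le> C * norm x)"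

text \<open>On \<open>D\<close> any coefficients in the unit ball are allowed, not only signs,
  because the vectors compared later carry actual coefficients bounded by a threshold. Disjointness
  matches the pair \<open>A - B\<close>, \<open>B - A\<close> in the approximation errors.\<close>

definition disjoint_democratic :: "(nat set \<Rightarrow> ennreal) \<Rightarrow> real \<Rightarrow> bool" where
  "disjoint_democratic w C \<longleftrightarrow> C \<ge> 1 \<and>
     (\<forall>D B b \<epsilon>. finite D \<longrightarrow> finite B \<longrightarrow> D \<inter> B = {} \<longrightarrow> w D \<le> w B \<longrightarrow>
        (\<forall>n\<in>D. norm (b n) \<le> 1) \<longrightarrow> (\<forall>n\<in>B. norm (\<epsilon> n) = 1) \<longrightarrow>
        norm (lincomb D b) \<le> C * norm (lincomb B \<epsilon>))"

lemma quasi_greedyD: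
  "quasi_greedy C \<Longrightarrow> finite \<Lambda> \<Longrightarrow> (\<And>n k. n \<in> \<Lambda> \<Longrightarrow> k \<notin> \<Lambda> \<Longrightarrow> norm (es k x) \<le> norm (es n x)) \<Longrightarrow>
    norm (P \<Lambda> x) \<le> C * norm x"
  by (simp add: quasi_greedy_def greedy_set_def)

text \<open>The identity used is \<open>\<alpha>\<close> times the sign sum = \<open>P G u\<close>
  minus the sum of the terms of \<open>u\<close> weighted by \<open>g n\<close>. Since
  \<open>g\<close> increases with the modulus of the coefficient, its superlevel sets are greedy
  sets of \<open>u\<close>, so the layer cake bound applies; each of the two parts costs
  \<open>C * norm u\<close>.\<close>

lemma quasi_greedy_level_signs:
  fixes u :: 'a
  assumes "quasi_greedy C" "\<alpha> > 0"
  defines "G \<equiv> {n. \<alpha> \<le> norm (es n u)}"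
  shows "\<alpha> * norm (lincomb G (\<lambda>n. sgn (es n u))) \<le> 2 * C * norm u"
proof -
  define g where "g n = 1 - \<alpha> / norm (es n u)" for n
  have fin: "finite G"
    using finite_large_coeffs[OF assms(2)] by (simp add: G_def)
  have "norm (\<Sum>n\<in>G. g n *\<^sub>R smul (es n u) (e n)) \<le> 1 * (C * norm u)"
  proof (rule norm_weighted_sum_le[OF fin])
    show "0 \<le> g n \<and> g n \<le> 1" if "n \<in> G" for n
      using that assms(2) by (auto simp: g_def G_def divide_le_eq)
    fix H
    assume H: "H \<subseteq> G" "\<And>h k. h \<in> H \<Longrightarrow> k \<in> G - H \<Longrightarrow> g k \<le> g h"
    have "norm (P H u) \<le> C * norm u"
    proof (rule quasi_greedyD[OF assms(1)])
      show "finite H"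
        using H(1) fin finite_subset by blast
      fix n k
      assume nk: "n \<in> H" "k \<notin> H"
      show "norm (es k u) \<le> norm (es n u)"
      proof (cases "k \<in> G")
        case True
        have pos: "0 < norm (es n u)" "0 < norm (es k u)"
          using True nk H(1) assms(2) unfolding G_def by force+
        have "\<alpha> / norm (es n u) \<le> \<alpha> / norm (es k u)"
          using H(2)[of n k] nk True by (simp add: g_def)
        then show ?thesis
          using pos assms(2) by (simp add: divide_le_cancel frac_le_eq field_simps)
      next
        case False
        then show ?thesis
          using nk H(1) unfolding G_def by fastforce
      qed
    qed
    then show "norm (\<Sum>n\<in>H. smul (es n u) (e n)) \<le> C * norm u"
      by (simp add: proj_def)
  qed auto
  moreover have "norm (P G u) \<le> C * norm u"
    by (rule quasi_greedyD[OF assms(1) fin]) (auto simp: G_def)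
  moreover have "\<alpha> *\<^sub>R lincomb G (\<lambda>n. sgn (es n u)) = P G u - (\<Sum>n\<in>G. g n *\<^sub>R smul (es n u) (e n))"
  proof -
    have "\<alpha> *\<^sub>R smul (sgn (es n u)) (e n)
        = smul (es n u) (e n) - g n *\<^sub>R smul (es n u) (e n)" for n
    proof -
      have "smul (sgn (es n u)) (e n) = (inverse (norm (es n u))) *\<^sub>R smul (es n u) (e n)"
        by (simp add: sgn_div_norm scaleR_conv_of_real flip: scale_scale smul_of_real)
      then show ?thesis
        by (simp add: g_def scaleR_left_diff_distrib divide_inverse)
    qed
    then show ?thesis
      by (simp add: lincomb_def proj_def scaleR_sum_right sum_subtractf)
  qed
  then have "\<alpha> * norm (lincomb G (\<lambda>n. sgn (es n u)))
      = norm (P G u - (\<Sum>n\<in>G. g n *\<^sub>R smul (es n u) (e n)))"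
    using assms(2) by (metis abs_of_pos norm_scaleR)
  ultimately show ?thesis
    using norm_triangle_ineq4[of "P G u" "\<Sum>n\<in>G. g n *\<^sub>R smul (es n u) (e n)"] by simp
qed

text \<open>All nonzero coefficients of the sign vector on the full level set \<open>G\<close> have
  modulus 1, so every subset \<open>B\<close> of \<open>G\<close> is a greedy set of it. Passing
  from \<open>G\<close> to \<open>B\<close> costs the second factor \<open>C\<close>.\<close>

lemma quasi_greedy_signs:
  assumes "quasi_greedy C" "\<alpha> > 0" "\<And>n. n \<in> B \<Longrightarrow> \<alpha> \<le> norm (es n u)"
  shows "\<alpha> * norm (lincomb B (\<lambda>n. sgn (es n u))) \<le> 2 * C\<^sup>2 * norm u"
proof -
  define G where "G = {n. \<alpha> \<le> norm (es n u)}"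
  define v where "v = lincomb G (\<lambda>n. sgn (es n u))"
  have "finite G" "B \<subseteq> G"
    using finite_large_coeffs[OF assms(2)] assms(3) by (auto simp: G_def)
  then have fin: "finite G" "B \<subseteq> G" "finite B"
    by (auto intro: finite_subset)
  have "norm (P B v) \<le> C * norm v"
  proof (rule quasi_greedyD[OF assms(1) fin(3)])
    fix n k
    assume "n \<in> B"
    then have "norm (es n v) = 1"
      using assms(2) assms(3)[of n] fin by (auto simp: v_def es_lincomb norm_sgn)
    then show "norm (es k v) \<le> norm (es n v)"
      using fin by (auto simp: v_def es_lincomb norm_sgn)
  qed
  moreover have "P B v = lincomb B (\<lambda>n. sgn (es n u))"
    using fin by (simp add: v_def P_lincomb Int_absorb2)
  ultimately have "\<alpha> * norm (lincomb B (\<lambda>n. sgn (es n u))) \<le> C * (\<alpha> * norm v)"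
    using assms(2) by (simp add: mult.left_commute)
  also have "\<dots> \<le> C * (2 * C * norm u)"
    using quasi_greedy_level_signs[OF assms(1,2), of u] assms(1)
    unfolding v_def G_def by (intro mult_left_mono) (auto simp: quasi_greedy_def)
  finally show ?thesis
    by (simp add: power2_eq_square mult_ac)
qed

text \<open>After division by \<open>r * \<alpha>\<close> democracy compares \<open>b\<close> on
  \<open>D\<close> with the signs of \<open>u\<close> on \<open>B\<close>, and these are controlled
  by \<open>u\<close> itself. The factor \<open>r\<close> is 1 for coefficients of \<open>x\<close>
  and 2 for differences of two vectors with coefficients up to \<open>\<alpha>\<close>.\<close>

lemma democratic_compare:
  assumes "quasi_greedy C" "disjoint_democratic w C'"
    and "finite D" "finite B" "D \<inter> B = {}" "w D \<le> w B" "\<alpha> \<ge> 0" "r > 0"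
    and "\<And>n. n \<in> D \<Longrightarrow> norm (b n) \<le> r * \<alpha>" "\<And>n. n \<in> B \<Longrightarrow> \<alpha> \<le> norm (es n u)"
  shows "norm (lincomb D b) \<le> r * (2 * C\<^sup>2 * C') * norm u"
proof (cases "\<alpha> = 0")
  case True
  then have "lincomb D b = 0"
    using assms(9) by (simp add: lincomb_def)
  then show ?thesis
    using assms by (simp add: disjoint_democratic_def)
next
  case False
  then have "\<alpha> > 0"
    using assms by simp
  define b' where "b' n = of_real (inverse (r * \<alpha>)) * b n" for n
  have "norm (b' n) \<le> 1" if "n \<in> D" for n
  proof -
    have "norm (b' n) = norm (b n) / (r * \<alpha>)"
      using \<open>\<alpha> > 0\<close> \<open>r > 0\<close> unfolding b'_def norm_mult norm_of_real by (simp add: divide_inverse)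
    then show ?thesis
      using assms(9)[OF that] \<open>\<alpha> > 0\<close> \<open>r > 0\<close> by simp
  qed
  moreover have "norm (sgn (es n u)) = 1" if "n \<in> B" for n
    using assms(10)[OF that] \<open>\<alpha> > 0\<close> by (auto simp: norm_sgn)
  ultimately have "norm (lincomb D b') \<le> C' * norm (lincomb B (\<lambda>n. sgn (es n u)))"
    using assms(2-6) by (simp add: disjoint_democratic_def)
  moreover have "lincomb D b' = inverse (r * \<alpha>) *\<^sub>R lincomb D b"
    unfolding b'_def by (rule lincomb_scaleR)
  ultimately have "norm (lincomb D b) \<le> r * C' * (\<alpha> * norm (lincomb B (\<lambda>n. sgn (es n u))))"
    using \<open>\<alpha> > 0\<close> \<open>r > 0\<close> by (simp add: field_simps)
  also have "\<dots> \<le> r * C' * (2 * C\<^sup>2 * norm u)"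
    using quasi_greedy_signs[OF assms(1) \<open>\<alpha> > 0\<close> assms(10)] assms(2) \<open>r > 0\<close>
    by (intro mult_left_mono) (auto simp: disjoint_democratic_def)
  finally show ?thesis
    by (simp add: mult_ac)
qed

text \<open>The threshold is the least modulus on the greedy set. That it is attained serves to
  bound it by the norm of \<open>x\<close>.\<close>

lemma greedy_threshold:
  assumes "greedy_set es x m \<Lambda>" "m \<ge> 1"
  obtains \<alpha> where "\<alpha> \<ge> 0" "\<And>n. n \<in> \<Lambda> \<Longrightarrow> \<alpha> \<le> norm (es n x)"
    "\<And>n. n \<notin> \<Lambda> \<Longrightarrow> norm (es n x) \<le> \<alpha>" "\<exists>n\<in>\<Lambda>. \<alpha> = norm (es n x)"
proof -
  have "finite \<Lambda>" "\<Lambda> \<noteq> {}"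
    using assms by (auto simp: greedy_set_def)
  then obtain n0 where "n0 \<in> \<Lambda>" "\<And>n. n \<in> \<Lambda> \<Longrightarrow> norm (es n0 x) \<le> norm (es n x)"
    using ex_is_arg_min_if_finite[of \<Lambda> "\<lambda>n. norm (es n x)"]
    by (auto simp: is_arg_min_linorder)
  then show thesis
    using assms by (intro that[of "norm (es n0 x)"]) (auto simp: greedy_set_def)
qed

section \<open>The infima that define the approximation errors\<close>

lemma sigma_w_greatest:
  assumes "finite B" "\<And>A a. finite A \<Longrightarrow> w (A - B) \<le> w (B - A) \<Longrightarrow> t \<le> norm (x - lincomb A a)"
  shows "t \<le> sigma_w smul e w B x"
  unfolding sigma_w_def
proof (rule cInf_greatest)
  \<comment> \<open>\<open>A = B\<close> is always admissible, both set differences being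
    empty.\<close>
  show "{norm (x - (\<Sum>n\<in>A. smul (a n) (e n))) | A a. finite A \<and> w (A - B) \<le> w (B - A)} \<noteq> {}"
    using assms(1) by (auto intro: exI[of _ B])
qed (use assms in \<open>auto simp: lincomb_def\<close>)

lemma sigma_tilde_w_greatest:
  assumes "finite B" "\<And>A. finite A \<Longrightarrow> w (A - B) \<le> w (B - A) \<Longrightarrow> t \<le> norm (x - P A x)"
  shows "t \<le> sigma_tilde_w smul e es w B x"
  unfolding sigma_tilde_w_def
proof (rule cInf_greatest)
  show "{norm (x - P A x) | A. finite A \<and> w (A - B) \<le> w (B - A)} \<noteq> {}"
    using assms(1) by (auto intro: exI[of _ B])
qed (use assms in auto)

lemma sigma_tilde_w_le:
  assumes "finite A" "w (A - B) \<le> w (B - A)"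
  shows "sigma_tilde_w smul e es w B x \<le> norm (x - P A x)"
  unfolding sigma_tilde_w_def
  by (rule cInf_lower) (use assms in \<open>auto intro!: bdd_belowI[of _ 0]\<close>)


section \<open>Almost greedy bases\<close>

text \<open>With \<open>u = x - P A x\<close>, the error \<open>x - P \<Lambda> x\<close> is
  \<open>u\<close>, minus the projection of \<open>u\<close> onto its greedy set
  \<open>\<Lambda> - A\<close>, plus the part of \<open>x\<close> on \<open>A - \<Lambda>\<close>.
  The last part has coefficients at most \<open>\<alpha>\<close> and is compared with
  \<open>u\<close> on \<open>\<Lambda> - A\<close>. The three parts give the summands of
  \<open>L\<close>.\<close>

lemma almost_greedy_if_quasi_greedy_democratic:
  assumes qg: "quasi_greedy C" and dem: "disjoint_democratic w C'"
  shows "almost_greedy smul w e es"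
proof -
  define L where "L = 1 + C + 2 * C\<^sup>2 * C'"
  have C: "C \<ge> 1" "C' \<ge> 1"
    using assms by (auto simp: quasi_greedy_def disjoint_democratic_def)
  then have L: "L \<ge> 1"
    by (simp add: L_def)
  have "norm (x - P \<Lambda> x) \<le> L * sigma_tilde_w smul e es w \<Lambda> x"
    if m: "m \<ge> 1" and greedy: "greedy_set es x m \<Lambda>" for x m \<Lambda>
  proof -
    obtain \<alpha> where \<alpha>: "\<alpha> \<ge> 0" "\<And>n. n \<in> \<Lambda> \<Longrightarrow> \<alpha> \<le> norm (es n x)"
        "\<And>n. n \<notin> \<Lambda> \<Longrightarrow> norm (es n x) \<le> \<alpha>"
      using greedy_threshold[OF greedy m] by metis
    have fin: "finite \<Lambda>"
      using greedy by (simp add: greedy_set_def)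
    have "norm (x - P \<Lambda> x) / L \<le> norm (x - P A x)"
      if A: "finite A" "w (A - \<Lambda>) \<le> w (\<Lambda> - A)" for A
    proof -
      define u where "u = x - P A x"
      have es_u: "es n u = (if n \<in> A then 0 else es n x)" for n
        using A by (simp add: u_def es_diff es_P)
      have "norm (lincomb (A - \<Lambda>) (\<lambda>n. es n x)) \<le> 1 * (2 * C\<^sup>2 * C') * norm u"
        by (rule democratic_compare[OF qg dem, where B = "\<Lambda> - A" and \<alpha> = \<alpha>])
           (use \<alpha> A fin in \<open>auto simp: es_u\<close>)
      moreover have "norm (P (\<Lambda> - A) u) \<le> C * norm u"
        by (rule quasi_greedyD[OF qg])
           (use \<alpha> fin in \<open>auto simp: es_u intro: order_trans\<close>)
      moreover have "x - P \<Lambda> x = u - P (\<Lambda> - A) u + lincomb (A - \<Lambda>) (\<lambda>n. es n x)"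
      proof -
        have "P A x = P (A \<inter> \<Lambda>) x + P (A - \<Lambda>) x" "P \<Lambda> x = P (A \<inter> \<Lambda>) x + P (\<Lambda> - A) x"
          using lincomb_Un[of "A \<inter> \<Lambda>" "A - \<Lambda>"] lincomb_Un[of "A \<inter> \<Lambda>" "\<Lambda> - A"] A fin
          unfolding P_eq_lincomb
          by (metis Diff_disjoint Int_Diff Int_Diff_disjoint Int_Diff_Un finite_Diff finite_Int,
              metis Int_commute Int_Diff_disjoint Int_Diff_Un finite_Diff finite_Int)
        moreover have "P (\<Lambda> - A) u = P (\<Lambda> - A) x"
          by (simp add: P_eq_lincomb) (rule lincomb_cong, simp add: es_u)
        ultimately show ?thesis
          by (simp add: u_def P_eq_lincomb[of "A - \<Lambda>", symmetric])
      qed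
      then have "norm (x - P \<Lambda> x)
          \<le> norm u + norm (P (\<Lambda> - A) u) + norm (lincomb (A - \<Lambda>) (\<lambda>n. es n x))"
        using norm_triangle_ineq[of "u - P (\<Lambda> - A) u" "lincomb (A - \<Lambda>) (\<lambda>n. es n x)"]
          norm_triangle_ineq4[of u "P (\<Lambda> - A) u"] by simp
      ultimately have "norm (x - P \<Lambda> x) \<le> L * norm u"
        by (simp add: L_def algebra_simps)
      then show ?thesis
        using L by (simp add: u_def field_simps)
    qed
    then have "norm (x - P \<Lambda> x) / L \<le> sigma_tilde_w smul e es w \<Lambda> x"
      using fin by (intro sigma_tilde_w_greatest) auto
    then show ?thesis
      using L by (simp add: field_simps)
  qed
  with L show ?thesis
    unfolding almost_greedy_def by blast
qed

lemma almost_greedyE: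
  assumes "almost_greedy smul w e es"
  obtains C where "C \<ge> 1" "\<And>x \<Lambda> A. greedy_set es x (card \<Lambda>) \<Lambda> \<Longrightarrow> \<Lambda> \<noteq> {} \<Longrightarrow> finite A \<Longrightarrow>
    w (A - \<Lambda>) \<le> w (\<Lambda> - A) \<Longrightarrow> norm (x - P \<Lambda> x) \<le> C * norm (x - P A x)"
proof -
  obtain C where C: "C \<ge> 1" "\<And>x m \<Lambda>. m \<ge> 1 \<Longrightarrow> greedy_set es x m \<Lambda> \<Longrightarrow>
      norm (x - P \<Lambda> x) \<le> C * sigma_tilde_w smul e es w \<Lambda> x"
    using assms unfolding almost_greedy_def by blast
  have "norm (x - P \<Lambda> x) \<le> C * norm (x - P A x)"
    if "greedy_set es x (card \<Lambda>) \<Lambda>" "\<Lambda> \<noteq> {}" "finite A" "w (A - \<Lambda>) \<le> w (\<Lambda> - A)" for x \<Lambda> A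
  proof -
    have "card \<Lambda> \<ge> 1"
      using that by (simp add: greedy_set_def Suc_le_eq card_gt_0_iff)
    then have "norm (x - P \<Lambda> x) \<le> C * sigma_tilde_w smul e es w \<Lambda> x"
      using that C(2) by blast
    also have "\<dots> \<le> C * norm (x - P A x)"
      using that C(1) by (intro mult_left_mono sigma_tilde_w_le) auto
    finally show ?thesis .
  qed
  with C(1) show thesis by (rule that)
qed

text \<open>The empty competitor is admissible and its error is \<open>norm x\<close>.\<close>

lemma almost_greedy_imp_quasi_greedy:
  assumes "almost_greedy smul w e es" "w {} = 0"
  shows "\<exists>C. quasi_greedy C"
proof -
  obtain C where C: "C \<ge> 1" "\<And>x \<Lambda> A. greedy_set es x (card \<Lambda>) \<Lambda> \<Longrightarrow> \<Lambda> \<noteq> {} \<Longrightarrow> finite A \<Longrightarrow>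
    w (A - \<Lambda>) \<le> w (\<Lambda> - A) \<Longrightarrow> norm (x - P \<Lambda> x) \<le> C * norm (x - P A x)"
    using almost_greedyE[OF assms(1)] by metis
  have "norm (P \<Lambda> x) \<le> (1 + C) * norm x" if "greedy_set es x (card \<Lambda>) \<Lambda>" for x \<Lambda>
  proof (cases "\<Lambda> = {}")
    case True
    then show ?thesis
      using C(1) by (simp add: P_eq_lincomb)
  next
    case False
    then have "norm (x - P \<Lambda> x) \<le> C * norm x"
      using C(2)[OF that, of "{}"] assms(2) by (simp add: P_eq_lincomb)
    then show ?thesis
      using norm_triangle_sub[of "P \<Lambda> x" x] by (simp add: norm_minus_commute algebra_simps)
  qed
  with C(1) have "quasi_greedy (1 + C)"
    by (simp add: quasi_greedy_def)
  then show ?thesis ..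
qed

text \<open>In the sum of the two combinations \<open>B\<close> is a greedy set and \<open>D\<close>
  is an admissible competitor; removing either one leaves the other.\<close>

lemma almost_greedy_imp_democratic:
  assumes "almost_greedy smul w e es" "w {} = 0" "\<And>A. A \<noteq> {} \<Longrightarrow> 0 < w A"
  shows "\<exists>C. disjoint_democratic w C"
proof -
  obtain C where C: "C \<ge> 1" "\<And>x \<Lambda> A. greedy_set es x (card \<Lambda>) \<Lambda> \<Longrightarrow> \<Lambda> \<noteq> {} \<Longrightarrow> finite A \<Longrightarrow>
    w (A - \<Lambda>) \<le> w (\<Lambda> - A) \<Longrightarrow> norm (x - P \<Lambda> x) \<le> C * norm (x - P A x)"
    using almost_greedyE[OF assms(1)] by metis
  have "norm (lincomb D b) \<le> C * norm (lincomb B \<epsilon>)"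
    if DB: "finite D" "finite B" "D \<inter> B = {}" "w D \<le> w B"
      and b: "\<forall>n\<in>D. norm (b n) \<le> 1" and \<epsilon>: "\<forall>n\<in>B. norm (\<epsilon> n) = 1" for D B b \<epsilon>
  \<comment> \<open>Greedy sets are tested only when nonempty; for empty \<open>B\<close>,
    positivity of the weight forces \<open>D\<close> to be empty.\<close>
  proof (cases "B = {}")
    case True
    then have "D = {}"
      using DB assms(2) assms(3)[of D] by (metis not_less)
    with True show ?thesis by simp
  next
    case False
    define x where "x = lincomb D b + lincomb B \<epsilon>"
    have "es n x = (if n \<in> B then \<epsilon> n else if n \<in> D then b n else 0)" for n
      using DB by (auto simp: x_def es_add es_lincomb)
    then have "greedy_set es x (card B) B"
      using DB b \<epsilon> by (auto simp: greedy_set_def)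
    moreover have "D - B = D" "B - D = B"
      using DB by auto
    ultimately have "norm (x - P B x) \<le> C * norm (x - P D x)"
      using C(2) False DB by simp
    moreover have "P B x = lincomb B \<epsilon>" "P D x = lincomb D b"
      using DB by (auto simp: x_def P_add P_lincomb Int_commute)
    ultimately show ?thesis
      by (simp add: x_def)
  qed
  with C(1) have "disjoint_democratic w C"
    by (simp add: disjoint_democratic_def)
  then show ?thesis ..
qed


section \<open>Semi-greedy bases\<close>

text \<open>
  Given an approximation error \<open>u = x - z\<close> with \<open>z\<close> supported in \<open>A\<close>, truncating the coefficients
  of \<open>u\<close> at the greedy threshold \<open>\<alpha>\<close> of \<open>x\<close> leaves the coefficients off \<open>A \<union> \<Lambda>\<close> unchanged.
  Correcting those on \<open>A - \<Lambda>\<close>, which costs a vector with coefficients bounded by \<open>2\<alpha>\<close>, produces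
  a competitor in the Chebyshev problem on \<open>\<Lambda>\<close>.
\<close>

lemma semi_greedy_if_quasi_greedy_democratic:
  assumes qg: "quasi_greedy C" and dem: "disjoint_democratic w C'"
  shows "semi_greedy smul w e es"
proof -
  \<comment> \<open>The truncation \<open>T\<close> costs \<open>1 + C + 2 * C\<close>, from
    \<open>u\<close>, \<open>P G u\<close> and the sign sum; the correction on
    \<open>A - \<Lambda>\<close> costs twice \<open>2 * C\<^sup>2 * C'\<close>.\<close>
  define L where "L = 1 + 3 * C + 4 * C\<^sup>2 * C'"
  have C: "C \<ge> 1" "C' \<ge> 1"
    using assms by (auto simp: quasi_greedy_def disjoint_democratic_def)
  then have L: "L \<ge> 1"
    by (simp add: L_def)
  have "norm (x - y) \<le> L * sigma_w smul e w \<Lambda> x"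
    if m: "m \<ge> 1" and greedy: "greedy_set es x m \<Lambda>"
      and cheb: "chebyshev_greedy_sum smul e es x \<Lambda> y" for x m \<Lambda> y
  proof -
    obtain \<alpha> where \<alpha>: "\<alpha> \<ge> 0" "\<And>n. n \<in> \<Lambda> \<Longrightarrow> \<alpha> \<le> norm (es n x)"
        "\<And>n. n \<notin> \<Lambda> \<Longrightarrow> norm (es n x) \<le> \<alpha>"
      using greedy_threshold[OF greedy m] by metis
    have fin: "finite \<Lambda>"
      using greedy by (simp add: greedy_set_def)
    \<comment> \<open>A vector with the coefficients of \<open>x\<close> off
      \<open>\<Lambda>\<close> differs from \<open>x\<close> by a combination over
      \<open>\<Lambda>\<close>, so it is the error of a Chebyshev competitor.\<close>
    have best: "norm (x - y) \<le> norm v" if "\<And>n. n \<notin> \<Lambda> \<Longrightarrow> es n v = es n x" for v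
    proof -
      have "P \<Lambda> (x - v) = x - v"
        by (rule P_eq_self[OF fin]) (simp add: that es_diff)
      moreover have "norm (x - y) \<le> norm (x - P \<Lambda> (x - v))"
        using cheb fin by (simp add: chebyshev_greedy_sum_iff P_eq_lincomb)
      ultimately show ?thesis by simp
    qed
    have "norm (x - y) / L \<le> norm (x - lincomb A a)"
      if A: "finite A" "w (A - \<Lambda>) \<le> w (\<Lambda> - A)" for A a
    proof (cases "\<alpha> = 0")
      case True
      \<comment> \<open>With threshold 0 the coefficients of \<open>x\<close> off
        \<open>\<Lambda>\<close> vanish, so the zero vector agrees with \<open>x\<close>
        there.\<close>
      have "norm (x - y) \<le> norm (0 :: 'a)"
        by (rule best) (use \<alpha> True in auto)
      then show ?thesis by simp
    next
      case False
      with \<alpha> have "\<alpha> > 0" by simp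
      define u where "u = x - lincomb A a"
      define G where "G = {n. \<alpha> \<le> norm (es n u)}"
      have finG: "finite G"
        unfolding G_def by (rule finite_large_coeffs) fact
      define s where "s = lincomb G (\<lambda>n. sgn (es n u))"
      define T where "T = u - P G u + \<alpha> *\<^sub>R s"
      define v where "v = T + lincomb (A - \<Lambda>) (\<lambda>n. es n x - es n T)"
      have es_u: "es n u = es n x" if "n \<notin> A" for n
        using that A by (simp add: u_def es_diff es_lincomb)
      have es_T: "es n T = (if n \<in> G then of_real \<alpha> * sgn (es n u) else es n u)" for n
        using finG by (simp add: T_def s_def es_add es_diff es_P es_scaleR es_lincomb)
      have T_le: "norm (es n T) \<le> \<alpha>" for n
        using \<open>\<alpha> > 0\<close> by (auto simp: es_T norm_mult norm_sgn G_def)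
      have "norm (x - y) \<le> norm v"
      proof (rule best)
        fix n assume n: "n \<notin> \<Lambda>"
        show "es n v = es n x"
        proof (cases "n \<in> A")
          case True
          then show ?thesis
            using n A by (simp add: v_def es_add es_lincomb)
        next
          case False
          \<comment> \<open>Off \<open>\<Lambda>\<close> the modulus is at most
            \<open>\<alpha>\<close>, and in \<open>G\<close> it is at least \<open>\<alpha>\<close>;
            truncation leaves such a coefficient unchanged.\<close>
          have "of_real \<alpha> * sgn (es n x) = es n x" if "n \<in> G"
          proof -
            have "norm (es n x) = \<alpha>"
              using that \<alpha>(3)[OF n] es_u[OF False] by (simp add: G_def)
            then show ?thesis
              using \<open>\<alpha> > 0\<close> by (simp add: sgn_div_norm scaleR_conv_of_real flip: mult.assoc of_real_mult)
          qed
          then show ?thesis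
            using False A by (simp add: v_def es_add es_lincomb es_T es_u)
        qed
      qed
      moreover have "norm v \<le> norm T + norm (lincomb (A - \<Lambda>) (\<lambda>n. es n x - es n T))"
        unfolding v_def by (rule norm_triangle_ineq)
      moreover have "norm (lincomb (A - \<Lambda>) (\<lambda>n. es n x - es n T)) \<le> 2 * (2 * C\<^sup>2 * C') * norm u"
      proof (rule democratic_compare[OF qg dem, where B = "\<Lambda> - A" and \<alpha> = \<alpha>])
        show "norm (es n x - es n T) \<le> 2 * \<alpha>" if "n \<in> A - \<Lambda>" for n
          using norm_triangle_ineq4[of "es n x" "es n T"] T_le[of n] \<alpha>(3)[of n] that by simp
      qed (use \<alpha> A fin in \<open>auto simp: es_u\<close>)
      moreover have "norm T \<le> norm u + norm (P G u) + \<alpha> * norm s"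
      proof -
        have "norm T \<le> norm (u - P G u) + \<alpha> * norm s"
          using norm_triangle_ineq[of "u - P G u" "\<alpha> *\<^sub>R s"] \<alpha>(1) by (simp add: T_def)
        then show ?thesis
          using norm_triangle_ineq4[of u "P G u"] by linarith
      qed
      moreover have "norm (P G u) \<le> C * norm u"
        by (rule quasi_greedyD[OF qg finG]) (auto simp: G_def)
      moreover have "\<alpha> * norm s \<le> 2 * C * norm u"
        unfolding s_def G_def by (rule quasi_greedy_level_signs[OF qg \<open>\<alpha> > 0\<close>])
      ultimately have "norm (x - y) \<le> L * norm u"
        by (simp add: L_def algebra_simps)
      then show ?thesis
        using L by (simp add: u_def field_simps)
    qed
    then have "norm (x - y) / L \<le> sigma_w smul e w \<Lambda> x"
      using fin by (intro sigma_w_greatest) auto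
    then show ?thesis
      using L by (simp add: field_simps)
  qed
  with L show ?thesis
    unfolding semi_greedy_def by blast
qed

text \<open>Whatever the correction on \<open>B\<close> is, the error \<open>u\<close> keeps the
  signs \<open>s\<close> on \<open>D\<close>. Quasi-greediness bounds the sign sum over every subset
  of \<open>D\<close> by \<open>u\<close>, and the layer cake bound with weights
  \<open>norm (b n)\<close> turns these sums into the combination with coefficients
  \<open>b\<close>.\<close>

lemma semi_greedy_imp_democratic:
  assumes semi: "semi_greedy smul w e es" and qg: "quasi_greedy Q"
    and w: "w {} = 0" "\<And>A. A \<noteq> {} \<Longrightarrow> 0 < w A"
  shows "\<exists>C. disjoint_democratic w C"
proof -
  obtain C where C: "C \<ge> 1" "\<And>x \<Lambda> A a. greedy_set es x (card \<Lambda>) \<Lambda> \<Longrightarrow> \<Lambda> \<noteq> {} \<Longrightarrow> finite A \<Longrightarrow>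
    w (A - \<Lambda>) \<le> w (\<Lambda> - A) \<Longrightarrow> \<exists>c. norm (x - lincomb \<Lambda> c) \<le> C * norm (x - lincomb A a)"
    using semi_greedyE[OF semi] by metis
  have Q: "Q \<ge> 1"
    using qg by (simp add: quasi_greedy_def)
  have "norm (lincomb D b) \<le> 2 * Q\<^sup>2 * C * norm (lincomb B \<epsilon>)"
    if DB: "finite D" "finite B" "D \<inter> B = {}" "w D \<le> w B"
      and b: "\<forall>n\<in>D. norm (b n) \<le> 1" and \<epsilon>: "\<forall>n\<in>B. norm (\<epsilon> n) = 1" for D B b \<epsilon>
  proof (cases "B = {}")
    case True
    then have "D = {}"
      using DB w(1) w(2)[of D] by (metis not_less)
    with True show ?thesis by simp
  next
    case False
    \<comment> \<open>Signs replace \<open>b\<close> because \<open>quasi_greedy_signs\<close> needs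
      a positive lower bound on the coefficients; the value 1 where \<open>b\<close> vanishes keeps
      all moduli equal to 1.\<close>
    define s where "s n = (if b n = 0 then 1 else sgn (b n))" for n
    have norm_s: "norm (s n) = 1" for n
      by (simp add: s_def norm_sgn)
    define x where "x = lincomb D s + lincomb B \<epsilon>"
    have es_x: "es n x = (if n \<in> B then \<epsilon> n else if n \<in> D then s n else 0)" for n
      using DB by (auto simp: x_def es_add es_lincomb)
    then have "greedy_set es x (card B) B"
      using DB norm_s \<epsilon> by (auto simp: greedy_set_def)
    moreover have "D - B = D" "B - D = B"
      using DB by auto
    ultimately obtain c where c: "norm (x - lincomb B c) \<le> C * norm (x - lincomb D s)"
      using C(2)[of x B D s] False DB by auto
    define u where "u = x - lincomb B c"
    have es_u: "es n u = s n" if "n \<in> D" for n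
      using that DB by (auto simp: u_def es_diff es_x es_lincomb)
    have sub: "norm (lincomb H s) \<le> 2 * Q\<^sup>2 * norm u" if "H \<subseteq> D" for H
    proof -
      have "lincomb H (\<lambda>n. sgn (es n u)) = lincomb H s"
        using that norm_s by (intro lincomb_cong) (auto simp: es_u sgn_div_norm)
      moreover have "1 \<le> norm (es n u)" if "n \<in> H" for n
        using that \<open>H \<subseteq> D\<close> es_u norm_s by (metis order_refl subsetD)
      ultimately show ?thesis
        using quasi_greedy_signs[OF qg, of 1 H u] by simp
    qed
    have "norm (\<Sum>n\<in>D. norm (b n) *\<^sub>R smul (s n) (e n)) \<le> 1 * (2 * Q\<^sup>2 * norm u)"
      by (rule norm_weighted_sum_le) (use DB b sub in \<open>auto simp: lincomb_def\<close>)
    moreover have "norm (b n) *\<^sub>R smul (s n) (e n) = smul (b n) (e n)" for n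
    proof -
      have "of_real (norm (b n)) * s n = b n"
        by (auto simp: s_def sgn_div_norm scaleR_conv_of_real)
      then show ?thesis
        by (metis scale_scale smul_of_real)
    qed
    ultimately have "norm (lincomb D b) \<le> 2 * Q\<^sup>2 * norm u"
      by (simp add: lincomb_def)
    also have "\<dots> \<le> 2 * Q\<^sup>2 * (C * norm (lincomb B \<epsilon>))"
      using c by (intro mult_left_mono) (auto simp: u_def x_def)
    finally show ?thesis
      by (simp add: mult_ac)
  qed
  moreover have "2 * Q\<^sup>2 * C \<ge> 1"
    using mult_mono[of 1 "2 * Q\<^sup>2" 1 C] Q C(1) one_le_power[OF Q, of 2] by simp
  ultimately have "disjoint_democratic w (2 * Q\<^sup>2 * C)"
    by (simp add: disjoint_democratic_def)
  then show ?thesis ..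
qed

text \<open>
  If all finite sets far out are lighter than \<open>{0}\<close>, testing the semi-greedy condition with the
  greedy set \<open>{0}\<close> shows that the basis is equivalent to the unit vector basis of \<open>c\<^sub>0\<close>.
\<close>

lemma semi_greedy_imp_quasi_greedy_light_tail:
  assumes semi: "semi_greedy smul w e es"
    and light: "\<And>D. finite D \<Longrightarrow> D \<subseteq> {p..} \<Longrightarrow> w D \<le> w {0}"
  shows "\<exists>C. quasi_greedy C"
proof -
  obtain C where C: "C \<ge> 1" "\<And>x \<Lambda> A a. greedy_set es x (card \<Lambda>) \<Lambda> \<Longrightarrow> \<Lambda> \<noteq> {} \<Longrightarrow> finite A \<Longrightarrow>
    w (A - \<Lambda>) \<le> w (\<Lambda> - A) \<Longrightarrow> \<exists>c. norm (x - lincomb \<Lambda> c) \<le> C * norm (x - lincomb A a)"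
    using semi_greedyE[OF semi] by metis
  obtain K where K: "K \<ge> 1" "\<And>k x. norm (P {..<k} x) \<le> K * norm x"
    using basis_constant by auto
  obtain H where H: "H \<ge> 1" "\<And>n x. norm (es n x) \<le> H * norm x"
    using coeff_bound by auto
  \<comment> \<open>The maximum with 1 keeps index 0 out of the far sets.\<close>
  define p' where "p' = max p 1"
  define M where "M = (\<Sum>n<p'. norm (e n)) + (1 + K) * (C * norm (e 0))"
  have M: "M \<ge> 0"
    using C(1) K(1) by (auto simp: M_def intro!: add_nonneg_nonneg sum_nonneg)
  have far: "norm (lincomb D b) \<le> (1 + K) * (C * norm (e 0))"
    if D: "finite D" "D \<subseteq> {p'..}" and b: "\<And>n. n \<in> D \<Longrightarrow> norm (b n) \<le> 1" for D b
  proof -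
    \<comment> \<open>Removing the far part leaves the error \<open>e 0\<close>, while a correction
      on \<open>{0}\<close> cannot touch the far part; the cut at 1 separates the two.\<close>
    define x where "x = lincomb {0} (\<lambda>_. 1) + lincomb D b"
    have "0 \<notin> D"
      using D by (auto simp: p'_def)
    then have "greedy_set es x (card {0::nat}) {0}"
      using D b by (auto simp: greedy_set_def x_def es_add es_lincomb)
    moreover have "w (D - {0}) \<le> w ({0} - D)"
    proof -
      have "D \<subseteq> {p..}"
        using D(2) by (auto simp: p'_def)
      then show ?thesis
        using light[OF D(1)] \<open>0 \<notin> D\<close> by (simp add: insert_Diff_if)
    qed
    ultimately obtain c where c: "norm (x - lincomb {0} c) \<le> C * norm (x - lincomb D b)"
      using C(2)[of x "{0}" D b] D by auto
    have "x - lincomb {0} c = lincomb {0} (\<lambda>n. 1 - c n) + lincomb D b"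
      by (simp add: x_def lincomb_diff)
    moreover have "x - lincomb D b = e 0"
      by (simp add: x_def lincomb_def)
    moreover have "{..<1} \<inter> D = {}" "{..<1} \<inter> {0::nat} = {0}"
      using \<open>0 \<notin> D\<close> by auto
    then have "norm (lincomb D b)
        \<le> (1 + K) * norm (lincomb {0} (\<lambda>n. 1 - c n) + lincomb D b)"
      using D by (intro tail_bound(2)[OF K(2), of 1]) (simp_all add: P_lincomb)
    ultimately show ?thesis
      using c K(1) by (smt (verit) mult_left_mono)
  qed
  have bounded: "norm (lincomb D b) \<le> M"
    if D: "finite D" and b: "\<And>n. n \<in> D \<Longrightarrow> norm (b n) \<le> 1" for D b
  proof -
    have "lincomb D b = lincomb (D \<inter> {..<p'}) b + lincomb (D - {..<p'}) b"
      using D lincomb_Un[of "D \<inter> {..<p'}" "D - {..<p'}" b] by (simp add: Int_Diff_Un Int_Diff_disjoint)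
    moreover have "norm (lincomb (D \<inter> {..<p'}) b) \<le> (\<Sum>n<p'. norm (e n))"
    proof -
      have "norm (lincomb (D \<inter> {..<p'}) b) \<le> (\<Sum>n\<in>D \<inter> {..<p'}. norm (b n) * norm (e n))"
        by (rule norm_lincomb_le)
      also have "\<dots> \<le> (\<Sum>n\<in>D \<inter> {..<p'}. norm (e n))"
        using b by (intro sum_mono) (simp add: mult_left_le_one_le)
      also have "\<dots> \<le> (\<Sum>n<p'. norm (e n))"
        by (intro sum_mono2) auto
      finally show ?thesis .
    qed
    moreover have "norm (lincomb (D - {..<p'}) b) \<le> (1 + K) * (C * norm (e 0))"
      using D b by (intro far) auto
    ultimately show ?thesis
      using norm_triangle_ineq[of "lincomb (D \<inter> {..<p'}) b" "lincomb (D - {..<p'}) b"]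
      by (simp add: M_def)
  qed
  \<comment> \<open>Greediness of \<open>\<Lambda>\<close> does not enter: all coefficients divided
    by \<open>H * norm x\<close> lie in the unit ball, where every finite combination is bounded by
    \<open>M\<close>.\<close>
  have "norm (P \<Lambda> x) \<le> (1 + H * M) * norm x" if "finite \<Lambda>" for x \<Lambda>
  proof (cases "x = 0")
    case False
    define r where "r = H * norm x"
    have r: "r > 0"
      using False H(1) by (simp add: r_def)
    define b where "b n = of_real (inverse r) * es n x" for n
    have "norm (b n) \<le> 1" for n
    proof -
      have "norm (b n) = norm (es n x) / r"
        using r unfolding b_def norm_mult norm_of_real by (simp add: divide_inverse)
      then show ?thesis
        using H(2)[of n x] r by (simp add: r_def)
    qed
    then have "norm (lincomb \<Lambda> b) \<le> M"
      by (intro bounded that)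
    moreover have "lincomb \<Lambda> b = inverse r *\<^sub>R P \<Lambda> x"
      unfolding b_def P_eq_lincomb by (rule lincomb_scaleR)
    ultimately have "norm (P \<Lambda> x) \<le> r * M"
      using r by (simp add: field_simps)
    also have "\<dots> \<le> (1 + H * M) * norm x"
      by (simp add: r_def algebra_simps)
    finally show ?thesis .
  qed simp
  moreover have "1 + H * M \<ge> 1"
    using H(1) M by simp
  ultimately have "quasi_greedy (1 + H * M)"
    by (simp add: quasi_greedy_def greedy_set_def)
  then show ?thesis ..
qed

text \<open>
  Given a greedy set \<open>\<Lambda>\<close>, let \<open>E\<close> be a minimal interval beyond the support of \<open>x\<close> that is at least
  as heavy as \<open>\<Lambda>\<close>. Dropping its last point makes it lighter than \<open>\<Lambda>\<close>, and comparing that set with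
  \<open>\<Lambda>\<close> bounds \<open>\<alpha> \<parallel>1\<^sub>E\<parallel>\<close>; then replacing \<open>\<Lambda>\<close> by \<open>E\<close> in \<open>x\<close> bounds \<open>x - P \<Lambda> x\<close>.
\<close>

lemma semi_greedy_imp_quasi_greedy_heavy_tail:
  assumes semi: "semi_greedy smul w e es"
    and heavy: "\<And>\<Lambda> p. finite \<Lambda> \<Longrightarrow> \<exists>q. w \<Lambda> \<le> w {p..<q}"
    and w: "w {} = 0" "\<And>A. A \<noteq> {} \<Longrightarrow> 0 < w A"
  shows "\<exists>C. quasi_greedy C"
proof -
  obtain C where C: "C \<ge> 1" "\<And>x \<Lambda> A a. greedy_set es x (card \<Lambda>) \<Lambda> \<Longrightarrow> \<Lambda> \<noteq> {} \<Longrightarrow> finite A \<Longrightarrow>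
    w (A - \<Lambda>) \<le> w (\<Lambda> - A) \<Longrightarrow> \<exists>c. norm (x - lincomb \<Lambda> c) \<le> C * norm (x - lincomb A a)"
    using semi_greedyE[OF semi] by metis
  obtain K where K: "K \<ge> 1" "\<And>k x. norm (P {..<k} x) \<le> K * norm x"
    using basis_constant by auto
  obtain H where H: "H \<ge> 1" "\<And>n x. norm (es n x) \<le> H * norm x"
    using coeff_bound by auto
  obtain M where M: "\<And>n. norm (e n) \<le> M"
    using e_bounded by blast
  have "M \<ge> 0"
    using M[of 0] norm_ge_zero order_trans by blast
  \<comment> \<open>The summand \<open>(1 + K) * C\<close> bounds the shortened interval, and
    \<open>H * M\<close> its last point. In \<open>L\<close>, the factor \<open>1 + L1\<close>
    bounds \<open>x\<close> plus the combination over the interval, and \<open>K\<close> pays for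
    cutting the interval off.\<close>
  define L1 where "L1 = (1 + K) * C + H * M"
  define L where "L = 1 + K * (C * (1 + L1))"
  have L1: "L1 \<ge> 0"
    using K(1) C(1) H(1) \<open>M \<ge> 0\<close> by (simp add: L1_def)
  have L: "L \<ge> 1"
    using K(1) C(1) L1 by (simp add: L_def)
  have main: "norm (P \<Lambda> x) \<le> L * norm x"
    if greedy: "greedy_set es x (card \<Lambda>) \<Lambda>" and "\<Lambda> \<noteq> {}"
      and px: "P {..<p} x = x" and \<Lambda>p: "\<Lambda> \<subseteq> {..<p}" for x \<Lambda> p
  proof -
    have fin: "finite \<Lambda>"
      using greedy by (simp add: greedy_set_def)
    then have "card \<Lambda> \<ge> 1"
      using \<open>\<Lambda> \<noteq> {}\<close> by (simp add: Suc_le_eq card_gt_0_iff)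
    then obtain \<alpha> where \<alpha>: "\<alpha> \<ge> 0" "\<And>n. n \<in> \<Lambda> \<Longrightarrow> \<alpha> \<le> norm (es n x)"
        "\<And>n. n \<notin> \<Lambda> \<Longrightarrow> norm (es n x) \<le> \<alpha>" "\<exists>n\<in>\<Lambda>. \<alpha> = norm (es n x)"
      using greedy_threshold[OF greedy] by metis
    have es_x: "es n x = 0" if "n \<ge> p" for n
      using es_P[of "{..<p}" n x] px that by simp
    define q where "q = (LEAST q. w \<Lambda> \<le> w {p..<q})"
    have q: "w \<Lambda> \<le> w {p..<q}"
      unfolding q_def using heavy[OF fin, of p] by (rule LeastI_ex)
    then have "{p..<q} \<noteq> {}"
      using w(2)[OF \<open>\<Lambda> \<noteq> {}\<close>] w(1) by (metis not_less)
    then obtain r where r: "q = Suc r" "p \<le> r"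
      by (cases q) auto
    define E where "E = {p..<q}"
    define E' where "E' = {p..<r}"
    \<comment> \<open>Minimality of \<open>q\<close> excludes the reverse inequality, and weights
      are linearly ordered; monotonicity of \<open>w\<close> is not invoked.\<close>
    have "w E' \<le> w \<Lambda>"
      using not_less_Least[of r "\<lambda>q. w \<Lambda> \<le> w {p..<q}"] r by (simp add: q_def[symmetric] E'_def)
    have disj: "E - \<Lambda> = E" "\<Lambda> - E = \<Lambda>" "E' - \<Lambda> = E'" "\<Lambda> - E' = \<Lambda>"
      using \<Lambda>p by (auto simp: E_def E'_def)
    have finE: "finite E" "finite E'" "E \<noteq> {}"
      using \<open>{p..<q} \<noteq> {}\<close> by (auto simp: E_def E'_def)
    have tail: "P {..<p} (lincomb E a) = 0" "P {..<p} (lincomb E' a) = 0" for a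
    proof -
      have "{..<p} \<inter> E = {}" "{..<p} \<inter> E' = {}"
        by (auto simp: E_def E'_def)
      then show "P {..<p} (lincomb E a) = 0" "P {..<p} (lincomb E' a) = 0"
        using finE by (simp_all add: P_lincomb)
    qed
    have head: "P {..<p} (lincomb \<Lambda> a) = lincomb \<Lambda> a" for a
      using fin \<Lambda>p by (simp add: P_lincomb Int_absorb1)
    let ?\<alpha> = "\<lambda>_::nat. of_real \<alpha> :: 'k"
    have E': "norm (lincomb E' ?\<alpha>) \<le> (1 + K) * C * norm x"
    proof -
      \<comment> \<open>The added coefficients equal the threshold, so \<open>\<Lambda>\<close>
        remains greedy. The competitor on \<open>E'\<close> leaves \<open>x\<close>, and the
        correction on \<open>\<Lambda>\<close> lies before \<open>p\<close>.\<close>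
      define z where "z = x + lincomb E' ?\<alpha>"
      have es_z: "es n z = (if n \<in> E' then of_real \<alpha> else es n x)" for n
        using finE es_x by (auto simp: z_def es_add es_lincomb E'_def)
      have "greedy_set es z (card \<Lambda>) \<Lambda>"
        unfolding greedy_set_def
      proof (intro conjI ballI allI impI)
        fix n k assume "n \<in> \<Lambda>" "k \<notin> \<Lambda>"
        then show "norm (es k z) \<le> norm (es n z)"
          using \<alpha> disj by (auto simp: es_z intro: order_trans)
      qed (use fin in auto)
      then obtain c where "norm (z - lincomb \<Lambda> c) \<le> C * norm (z - lincomb E' ?\<alpha>)"
        using C(2)[of z \<Lambda> E' ?\<alpha>] \<open>\<Lambda> \<noteq> {}\<close> \<open>w E' \<le> w \<Lambda>\<close> finE disj by auto
      moreover have "z - lincomb \<Lambda> c = (x - lincomb \<Lambda> c) + lincomb E' ?\<alpha>"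
        "z - lincomb E' ?\<alpha> = x"
        by (simp_all add: z_def)
      moreover have "norm (lincomb E' ?\<alpha>) \<le> (1 + K) * norm ((x - lincomb \<Lambda> c) + lincomb E' ?\<alpha>)"
        by (rule tail_bound(2)[OF K(2), of p]) (simp_all add: P_diff px head tail)
      ultimately show ?thesis
        using K(1) by (smt (verit) mult_left_mono mult.assoc)
    qed
    have E: "norm (lincomb E ?\<alpha>) \<le> L1 * norm x"
    proof -
      have "lincomb E ?\<alpha> = lincomb E' ?\<alpha> + \<alpha> *\<^sub>R e r"
        using r by (simp add: E_def E'_def lincomb_def smul_of_real)
      then have "norm (lincomb E ?\<alpha>) \<le> norm (lincomb E' ?\<alpha>) + \<alpha> * norm (e r)"
        using norm_triangle_ineq[of "lincomb E' ?\<alpha>" "\<alpha> *\<^sub>R e r"] \<alpha>(1) by simp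
      \<comment> \<open>The threshold is an actual coefficient of \<open>x\<close>, hence at most
        \<open>H * norm x\<close>.\<close>
      moreover have "\<alpha> * norm (e r) \<le> (H * norm x) * M"
        using \<alpha>(1,4) H M[of r] by (intro mult_mono) auto
      ultimately show ?thesis
        using E' by (simp add: L1_def algebra_simps)
    qed
    \<comment> \<open>Now \<open>E\<close> is greedy, and the competitor on \<open>\<Lambda>\<close>
      may put the removed coefficients of \<open>x\<close> back. The correction lives on
      \<open>E\<close>, so the cut at \<open>p\<close> recovers
      \<open>x - P \<Lambda> x\<close>.\<close>
    define y where "y = x - P \<Lambda> x + lincomb E ?\<alpha>"
    have es_y: "es n y = (if n \<in> E then of_real \<alpha> else if n \<in> \<Lambda> then 0 else es n x)" for n
      using finE fin es_x \<Lambda>p by (auto simp: y_def es_add es_diff es_P es_lincomb E_def)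
    then have "greedy_set es y (card E) E"
      using finE \<alpha> by (auto simp: greedy_set_def)
    then obtain c where "norm (y - lincomb E c) \<le> C * norm (y - lincomb \<Lambda> (\<lambda>n. - es n x))"
      using C(2)[of y E \<Lambda> "\<lambda>n. - es n x"] fin finE disj q by (auto simp: E_def)
    moreover have "y - lincomb \<Lambda> (\<lambda>n. - es n x) = x + lincomb E ?\<alpha>"
      by (simp add: y_def P_eq_lincomb lincomb_def sum_negf)
    moreover have "norm (x + lincomb E ?\<alpha>) \<le> (1 + L1) * norm x"
      using norm_triangle_ineq[of x "lincomb E ?\<alpha>"] E by (simp add: algebra_simps)
    then have "C * norm (x + lincomb E ?\<alpha>) \<le> C * ((1 + L1) * norm x)"
      using C(1) by (intro mult_left_mono) auto
    moreover have "y - lincomb E c = (x - P \<Lambda> x) + lincomb E (\<lambda>n. of_real \<alpha> - c n)"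
      by (simp add: y_def lincomb_diff)
    moreover have "norm (x - P \<Lambda> x)
        \<le> K * norm ((x - P \<Lambda> x) + lincomb E (\<lambda>n. of_real \<alpha> - c n))"
      by (rule tail_bound(1)[OF K(2), of p])
         (simp_all add: P_diff px head tail P_eq_lincomb[of \<Lambda>])
    ultimately have "norm (x - P \<Lambda> x) \<le> K * (C * ((1 + L1) * norm x))"
      using K(1) by (smt (verit) mult_left_mono)
    then show ?thesis
      using norm_triangle_sub[of "P \<Lambda> x" x] by (simp add: L_def norm_minus_commute algebra_simps)
  qed
  have "norm (P \<Lambda> x) \<le> L * K * norm x" if greedy: "greedy_set es x (card \<Lambda>) \<Lambda>" for x \<Lambda>
  proof (cases "\<Lambda> = {}")
    case True
    then show ?thesis
      using L K(1) by (simp add: P_eq_lincomb)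
  next
    case False
    have fin: "finite \<Lambda>"
      using greedy by (simp add: greedy_set_def)
    then obtain p where p: "\<Lambda> \<subseteq> {..<p}"
      using finite_nat_iff_bounded by blast
    \<comment> \<open>A partial sum containing \<open>\<Lambda>\<close> keeps the coefficients there
      and only deletes others, so the finitely supported case applies at the cost of
      \<open>K\<close>.\<close>
    have "greedy_set es (P {..<p} x) (card \<Lambda>) \<Lambda>"
      using greedy p unfolding greedy_set_def by (auto simp: es_P subset_iff)
    then have "norm (P \<Lambda> (P {..<p} x)) \<le> L * norm (P {..<p} x)"
      using False p by (intro main[of _ _ p]) (simp_all add: P_P)
    also have "\<dots> \<le> L * (K * norm x)"
      using L by (intro mult_left_mono K) auto
    finally show ?thesis
      using fin p by (simp add: P_P Int_absorb2 mult.assoc)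
  qed
  moreover have "L * K \<ge> 1"
    using mult_mono[of 1 L 1 K] L K(1) by simp
  ultimately have "quasi_greedy (L * K)"
    by (simp add: quasi_greedy_def)
  then show ?thesis ..
qed

end


section \<open>Structured weights\<close>

text \<open>The alternative is whether the singleton weights are summable. If so, far sets have
  small singleton sums and hence small weight; if not, intervals starting at any \<open>p\<close>
  have arbitrarily large singleton sums and hence large weight.\<close>

lemma structured_weight_tail:
  assumes "structured_weight w"
  obtains (light) p where "\<And>D. finite D \<Longrightarrow> D \<subseteq> {p..} \<Longrightarrow> w D \<le> w {0}"
  | (heavy) "\<And>\<Lambda> p. finite \<Lambda> \<Longrightarrow> \<exists>q. w \<Lambda> \<le> w {p..<q}"
proof -
  define v where "v n = enn2real (w {n})" for n
  have w_fin: "w A < \<infinity>" if "finite A" for A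
    using assms that by (simp add: structured_weight_def)
  have w_v: "w {n} = ennreal (v n)" for n
    using w_fin[of "{n}"] by (simp add: v_def)
  have v_nonneg: "v n \<ge> 0" for n
    by (simp add: v_def)
  have sum_w: "(\<Sum>\<^sub>\<infinity>n\<in>A. w {n}) = ennreal (sum v A)" if "finite A" for A
    using that v_nonneg by (simp add: w_v)
  show thesis
  proof (cases "summable v")
    case True
    have "0 < w {0}"
      using assms by (simp add: structured_weight_def)
    then obtain \<theta> where \<theta>: "\<theta> > 0" "\<And>A. (\<Sum>\<^sub>\<infinity>n\<in>A. w {n}) < \<theta> \<Longrightarrow> w A < w {0}"
      using assms unfolding structured_weight_def by meson
    \<comment> \<open>\<open>\<theta>\<close> may be infinite, so a positive real below it is
      chosen.\<close>
    obtain t where t: "0 < t" "ennreal t < \<theta>"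
      using dense[OF \<theta>(1)] by (metis ennreal_cases ennreal_less_zero_iff top.extremum_strict)
    obtain p where p: "\<And>n. n \<ge> p \<Longrightarrow> norm (\<Sum>i. v (i + n)) < t"
      using suminf_exist_split[OF t(1) True] by blast
    have "w D \<le> w {0}" if "finite D" "D \<subseteq> {p..}" for D
    proof -
      have "sum v D = sum (\<lambda>i. v (i + p)) ((\<lambda>n. n - p) ` D)"
        using that by (subst sum.reindex)
          (auto simp: subset_iff intro!: sum.cong inj_on_diff_nat)
      also have "\<dots> \<le> (\<Sum>i. v (i + p))"
        using True that v_nonneg by (intro sum_le_suminf) auto
      also have "\<dots> < t"
        using p[of p] by simp
      finally have "(\<Sum>\<^sub>\<infinity>n\<in>D. w {n}) < \<theta>"
        using that t sum_w by (metis ennreal_leI less_imp_le order.strict_trans1)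
      then show ?thesis
        using \<theta>(2) less_imp_le by blast
    qed
    then show thesis by (rule light)
  next
    case False
    have "\<exists>q. w \<Lambda> \<le> w {p..<q}" if fin: "finite \<Lambda>" for \<Lambda> p
    proof -
      obtain R where R: "R < \<infinity>" "\<And>A. R < (\<Sum>\<^sub>\<infinity>n\<in>A. w {n}) \<Longrightarrow> w \<Lambda> < w A"
        using assms w_fin[OF fin] unfolding structured_weight_def by meson
      obtain B where B: "R = ennreal B" "B \<ge> 0"
        using R(1) by (cases R) auto
      \<comment> \<open>A shift by \<open>p\<close> does not affect summability, so the partial sums
        starting at \<open>p\<close> are unbounded as well.\<close>
      have "\<exists>n. B < (\<Sum>i<n. v (i + p))"
      proof (rule ccontr)
        assume "\<nexists>n. B < (\<Sum>i<n. v (i + p))"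
        then have "(\<Sum>i\<le>n. v (i + p)) \<le> B" for n
          by (metis lessThan_Suc_atMost not_less)
        then have "summable (\<lambda>i. v (i + p))"
          using v_nonneg by (intro bounded_imp_summable[of _ B]) auto
        with False show False by simp
      qed
      then obtain n where n: "B < (\<Sum>i<n. v (i + p))" ..
      also have "(\<Sum>i<n. v (i + p)) = sum v {p..<p + n}"
        using sum.shift_bounds_nat_ivl[of v 0 p n] by (simp add: atLeast0LessThan add.commute)
      finally have "R < (\<Sum>\<^sub>\<infinity>k\<in>{p..<p + n}. w {k})"
        using B sum_w[of "{p..<p + n}"] by (simp del: infsum_finite add: ennreal_lessI)
      then show ?thesis
        using R(2) less_imp_le by blast
    qed
    then show thesis by (rule heavy)
  qed
qed

context seminormalized_basis
begin

lemma semi_greedy_iff_almost_greedy: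
  assumes "structured_weight w"
  shows "semi_greedy smul w e es \<longleftrightarrow> almost_greedy smul w e es"
proof
  have w: "w {} = 0" "\<And>A. A \<noteq> {} \<Longrightarrow> 0 < w A"
    using assms by (auto simp: structured_weight_def)
  {
    assume semi: "semi_greedy smul w e es"
    have "\<exists>Q. quasi_greedy Q"
      using assms
    proof (cases rule: structured_weight_tail)
      case (light p)
      then show ?thesis
        by (rule semi_greedy_imp_quasi_greedy_light_tail[OF semi])
    next
      case heavy
      then show ?thesis
        by (rule semi_greedy_imp_quasi_greedy_heavy_tail[OF semi _ w])
    qed
    then obtain Q C where "quasi_greedy Q" "disjoint_democratic w C"
      using semi_greedy_imp_democratic[OF semi _ w] by blast
    then show "almost_greedy smul w e es"
      by (rule almost_greedy_if_quasi_greedy_democratic)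
  next
    assume almost: "almost_greedy smul w e es"
    obtain Q C where "quasi_greedy Q" "disjoint_democratic w C"
      using almost_greedy_imp_quasi_greedy[OF almost w(1)]
        almost_greedy_imp_democratic[OF almost w] by blast
    then show "semi_greedy smul w e es"
      by (rule semi_greedy_if_quasi_greedy_democratic)
  }
qed

end

theorem theorem4p2:
  fixes w :: "nat set \<Rightarrow> ennreal"
  assumes "structured_weight w"
  shows "(\<forall>(e :: nat \<Rightarrow> 'a::banach) (es :: nat \<Rightarrow> 'a \<Rightarrow> real).
            basis scaleR e es \<longrightarrow>
            (semi_greedy scaleR w e es \<longleftrightarrow> almost_greedy scaleR w e es))
       \<and> (\<forall>(smul :: complex \<Rightarrow> 'b::banach \<Rightarrow> 'b) (e :: nat \<Rightarrow> 'b) (es :: nat \<Rightarrow> 'b \<Rightarrow> complex).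
            complex_banach smul \<longrightarrow> basis smul e es \<longrightarrow>
            (semi_greedy smul w e es \<longleftrightarrow> almost_greedy smul w e es))"
proof (intro conjI allI impI)
  fix e :: "nat \<Rightarrow> 'a" and es :: "nat \<Rightarrow> 'a \<Rightarrow> real"
  assume basis: "basis scaleR e es"
  interpret seminormalized_basis scaleR e es
    by unfold_locales (simp_all add: basis scaleR_add_right scaleR_add_left)
  show "semi_greedy scaleR w e es \<longleftrightarrow> almost_greedy scaleR w e es"
    by (rule semi_greedy_iff_almost_greedy[OF assms])
next
  fix smul :: "complex \<Rightarrow> 'b \<Rightarrow> 'b" and e :: "nat \<Rightarrow> 'b" and es :: "nat \<Rightarrow> 'b \<Rightarrow> complex"
  assume "complex_banach smul" and basis: "basis smul e es"
  then interpret complex_banach smul by simp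
  interpret seminormalized_basis smul e es
    by unfold_locales (simp_all add: basis scale_of_real norm_scale)
  show "semi_greedy smul w e es \<longleftrightarrow> almost_greedy smul w e es"
    by (rule semi_greedy_iff_almost_greedy[OF assms])
qed

end
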